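(* There is a polynomial $p$ such that the following holds. Let $\pi=(D_1,\dots,D_l)$ be a $\mathsf{Res}$-$\mathsf{Lin}_U$ proof of $D_l$ from initial disjunctions of linear equations $Q_1,\dots,Q_m$ over variables $x_1,\dots,x_n$. Then there is a $\Sigma\Pi\Sigma$-$\mathsf{PC}_{\mathbb{Q}}$ derivation of (all polynomials of) $\widehat{D}_l$ from $\widehat{Q}_1\cup\dots\cup\widehat{Q}_m\cup\{x_h^2-x_h:1\le h\le n\}$ of size at most $O(p(Size(\pi)))$.
   Context: A linear equation is $a_1x_1+\dots+a_nx_n=a_0$ with $a_i\in\mathbb{Z}$; its affine form is $a_1x_1+\dots+a_nx_n-a_0$. A disjunction of linear equations $E_1\vee\dots\vee E_t$ ($t\ge0$) is satisfied by an integer assignment if some $E_j$ holds; equations in a disjunction are unordered. With coefficients written in unary, the size of a disjunction $\bigvee_{j=1}^t(a^{(j)}_1x_1+\dots+a^{(j)}_nx_n=a^{(j)}_0)$ is $\sum_{i=1}^n\sum_{j=1}^t|a_i^{(j)}|$. $\mathsf{Res}$-$\mathsf{Lin}_U$: a proof of $D$ from a collection $K$ of disjunctions is a sequence $D_1,\dots,D_l=D$ where each $D_i$ is in $K$, or is a Boolean axiom $(x_h=0)\vee(x_h=1)$, or follows from earlier lines by: Resolution (from $A\vee L_1$ and $B\vee L_2$ derive $A\vee B\vee(\alpha L_1+\beta L_2)$, $\alpha,\beta\in\mathbb{Z}$, the integer combination of the two equations); Weakening (from $A$ derive $A\vee L$ for any linear equation $L$); Simplification (from $A\vee(k=0)$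 with $k\ne0$ a constant derive $A$); Contraction (from $A\vee L\vee L$ derive $A\vee L$). Coefficients are written in unary; the size of a proof is the sum of the sizes of its lines. Translation: each affine form $L$ is assigned a variable $y_L$ (the same variable for the same affine form). For a disjunction $D$ whose equations have affine forms $L_1,\dots,L_t$, $\widehat D$ is the set of polynomials $\{y_{L_1}\cdots y_{L_t},\ y_{L_1}-L_1,\dots,y_{L_t}-L_t\}$ (each polynomial $P$ representing the equation $P=0$); for the empty disjunction, $\widehat D=\{1\}$. $\mathsf{PC}_{\mathbb{Q}}$ derivation from a set $\Gamma$: a sequence of rational polynomials each in $\Gamma$ or obtained from earlier lines by $\alpha R_j+\beta R_k$ ($\alpha,\beta\in\mathbb{Q}$) or by multiplication by a variable. A $\Sigma\Pi\Sigma$-$\mathsf{PC}_{\mathbb{Q}}$ derivation from $\Gamma$ is a $\mathsf{PC}_{\mathbb{Q}}$ derivation from $\Gamma\cup\{z_1-(a_{10}+\sum_j a_{1j}x_j),\dots,z_k-(a_{k0}+\sum_ja_{kj}x_j)\}$ for new variables $z_i$ and arbitrary constants $a_{ij}\in\mathbb{Q}$ (extension axioms defining new variables as affine forms). Size of a rational polynomial with coefficients $p_i/q_i$ is $\sum_i(\lceil\log|p_i|\rceil+\lceil\log q_i\rceil)$; size of a derivation is the sum of the sizes of its lines.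
   Formalization: The size of a disjunction also counts the free terms a_0 in unary (sum from i=0, not i=1); otherwise the claim fails: the one-line proof of x_1=2^N from itself has size 1, but its translation contains a polynomial of size N. *)

theory Defs
  imports Complex_Main "HOL-Library.Multiset" "HOL-Library.Poly_Mapping"
    "HOL-Computational_Algebra.Polynomial"
begin

section \<open>Linear equations, disjunctions and their size\<close>

text \<open>
  An equation \<open>a\<^sub>1 x\<^sub>1 + \<dots> + a\<^sub>n x\<^sub>n = a\<^sub>0\<close> is identified with its affine form
  \<open>a\<^sub>1 x\<^sub>1 + \<dots> + a\<^sub>n x\<^sub>n - a\<^sub>0\<close>.  The affine form is stored as the finitely supported
  function that maps \<open>i \<ge> 1\<close> to \<open>a\<^sub>i\<close> and \<open>0\<close> to the constant term \<open>- a\<^sub>0\<close>; it stands for the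
  equation ``form = 0''.  Disjunctions are multisets: the order of the disjuncts is irrelevant,
  but repetitions count (they are removed only by Contraction).
\<close>

type_synonym affine = "nat \<Rightarrow>\<^sub>0 int"
type_synonym disjunction = "affine multiset"

definition disj_over :: "nat \<Rightarrow> disjunction \<Rightarrow> bool" where
  "disj_over n D \<longleftrightarrow> (\<forall>L\<in>#D. Poly_Mapping.keys L \<subseteq> {0..n})"

text \<open>
  Unary size.  The sum includes the index \<open>0\<close>, so the free terms \<open>a\<^sub>0\<close> are counted in unary as
  well, as in Raz and Tzameret's definition of the size of a linear equation.  If the sum started
  at index \<open>1\<close>, the size of a Res-Lin proof would put no bound on its free terms: the one-line
  proof of \<open>x\<^sub>1 = 2 ^ N\<close> from itself would have size \<open>1\<close>, while every derivation of its
  translation contains a polynomial with the coefficient \<open>- 2 ^ N\<close>.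
\<close>

definition affine_size :: "affine \<Rightarrow> nat" where
  "affine_size L = (\<Sum>i\<in>Poly_Mapping.keys L. nat \<bar>Poly_Mapping.lookup L i\<bar>)"

definition disj_size :: "disjunction \<Rightarrow> nat" where
  "disj_size D = (\<Sum>L\<in>#D. affine_size L)"

definition reslin_size :: "disjunction list \<Rightarrow> nat" where
  "reslin_size \<pi> = (\<Sum>D\<leftarrow>\<pi>. disj_size D)"


section \<open>Res-Lin with unary coefficients\<close>

definition lin_comb :: "int \<Rightarrow> affine \<Rightarrow> int \<Rightarrow> affine \<Rightarrow> affine" where
  "lin_comb \<alpha> L \<beta> M = Poly_Mapping.map ((*) \<alpha>) L + Poly_Mapping.map ((*) \<beta>) M"

definition bool_axiom :: "nat \<Rightarrow> disjunction" where
  "bool_axiom h =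
     {# Poly_Mapping.single h 1, Poly_Mapping.single h 1 - Poly_Mapping.single 0 1 #}"

inductive reslin_step :: "nat \<Rightarrow> disjunction set \<Rightarrow> disjunction \<Rightarrow> bool"
  for n :: nat and P :: "disjunction set" where
  resolution: "\<lbrakk>add_mset L1 A \<in> P; add_mset L2 B \<in> P\<rbrakk>
    \<Longrightarrow> reslin_step n P (add_mset (lin_comb \<alpha> L1 \<beta> L2) (A + B))"
| weakening: "\<lbrakk>A \<in> P; Poly_Mapping.keys L \<subseteq> {0..n}\<rbrakk> \<Longrightarrow> reslin_step n P (add_mset L A)"
| simplification: "\<lbrakk>add_mset (Poly_Mapping.single 0 k) A \<in> P; k \<noteq> 0\<rbrakk> \<Longrightarrow> reslin_step n P A"
| contraction: "add_mset L (add_mset L A) \<in> P \<Longrightarrow> reslin_step n P (add_mset L A)"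

definition reslin_proof ::
    "nat \<Rightarrow> disjunction set \<Rightarrow> disjunction list \<Rightarrow> disjunction \<Rightarrow> bool" where
  "reslin_proof n K \<pi> D \<longleftrightarrow> \<pi> \<noteq> [] \<and> last \<pi> = D \<and>
     (\<forall>i<length \<pi>. \<pi> ! i \<in> K \<or> (\<exists>h\<in>{1..n}. \<pi> ! i = bool_axiom h)
        \<or> reslin_step n (set (take i \<pi>)) (\<pi> ! i))"


section \<open>Rational polynomials and polynomial calculus\<close>

text \<open>
  \<open>X i\<close> is the variable \<open>x\<^sub>i\<close>, \<open>Y L\<close> is the variable \<open>y\<^sub>L\<close> assigned to the affine form \<open>L\<close>, and
  the \<open>Z i\<close> are an infinite supply of further variables.
\<close>

datatype var = X nat | Y affine | Z nat

text \<open>Finitely supported maps from monomials (themselves exponent maps) to coefficients.\<close>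

type_synonym qpoly = "(var \<Rightarrow>\<^sub>0 nat) \<Rightarrow>\<^sub>0 rat"

definition Const :: "rat \<Rightarrow> qpoly" where
  "Const c = Poly_Mapping.single 0 c"

definition Var :: "var \<Rightarrow> qpoly" where
  "Var v = Poly_Mapping.single (Poly_Mapping.single v 1) 1"

definition poly_vars :: "qpoly \<Rightarrow> var set" where
  "poly_vars R = (\<Union>m\<in>Poly_Mapping.keys R. Poly_Mapping.keys m)"

definition affine_poly :: "nat \<Rightarrow> (nat \<Rightarrow> rat) \<Rightarrow> qpoly" where
  "affine_poly n a = Const (a 0) + (\<Sum>j=1..n. Const (a j) * Var (X j))"

text \<open>Coefficients are taken in lowest terms with positive denominator; logarithms are binary.\<close>

definition rat_size :: "rat \<Rightarrow> nat" where
  "rat_size c = (case quotient_of c of (p, q) \<Rightarrow>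
     nat \<lceil>log 2 (real_of_int \<bar>p\<bar>)\<rceil> + nat \<lceil>log 2 (real_of_int q)\<rceil>)"

definition qpoly_size :: "qpoly \<Rightarrow> nat" where
  "qpoly_size R = (\<Sum>m\<in>Poly_Mapping.keys R. rat_size (Poly_Mapping.lookup R m))"

definition pc_size :: "qpoly list \<Rightarrow> nat" where
  "pc_size \<rho> = (\<Sum>R\<leftarrow>\<rho>. qpoly_size R)"

inductive pc_step :: "qpoly set \<Rightarrow> qpoly \<Rightarrow> bool" for P :: "qpoly set" where
  combination: "\<lbrakk>R \<in> P; S \<in> P\<rbrakk> \<Longrightarrow> pc_step P (Const \<alpha> * R + Const \<beta> * S)"
| multiplication: "R \<in> P \<Longrightarrow> pc_step P (Var v * R)"

definition pc_derivation :: "qpoly set \<Rightarrow> qpoly list \<Rightarrow> bool" where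
  "pc_derivation \<Gamma> \<rho> \<longleftrightarrow>
     (\<forall>i<length \<rho>. \<rho> ! i \<in> \<Gamma> \<or> pc_step (set (take i \<rho>)) (\<rho> ! i))"

text \<open>
  The extension variables are pairwise distinct, are not among the \<open>x\<^sub>i\<close> and do not occur in
  \<open>\<Gamma>\<close>.  A variable \<open>Y L\<close> that does not occur in \<open>\<Gamma>\<close> may be used as an extension variable; this is
  how a form that occurs in the conclusion, but in no initial disjunction, receives its
  variable.
\<close>

definition sps_pc_derivation :: "nat \<Rightarrow> qpoly set \<Rightarrow> qpoly list \<Rightarrow> bool" where
  "sps_pc_derivation n \<Gamma> \<rho> \<longleftrightarrow>
     (\<exists>ext :: (var \<times> (nat \<Rightarrow> rat)) list.
        distinct (map fst ext) \<and>
        (\<forall>(z, a)\<in>set ext. z \<notin> range X \<and> z \<notin> (\<Union>R\<in>\<Gamma>. poly_vars R)) \<and>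
        pc_derivation (\<Gamma> \<union> {Var z - affine_poly n a | z a. (z, a) \<in> set ext}) \<rho>)"


section \<open>Translation of disjunctions\<close>

text \<open>For the empty disjunction the product is empty, so its translation is \<open>{1}\<close>.\<close>

definition hat :: "nat \<Rightarrow> disjunction \<Rightarrow> qpoly set" where
  "hat n D = insert (\<Prod>L\<in>#D. Var (Y L))
     ((\<lambda>L. Var (Y L) - affine_poly n (\<lambda>i. of_int (Poly_Mapping.lookup L i))) ` set_mset D)"

definition bool_polys :: "nat \<Rightarrow> qpoly set" where
  "bool_polys n = {Var (X h) ^ 2 - Var (X h) | h. 1 \<le> h \<and> h \<le> n}"

end

theory Submission
  imports Defs
begin

text \<open>
  Each line \<open>L\<^sub>1 \<or> \<dots> \<or> L\<^sub>t\<close> is simulated by a derivation of the monomial \<open>y\<^bsub>L\<^sub>1\<^esub> \<cdots> y\<^bsub>L\<^sub>t\<^esub>\<close>,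
  all of whose lines have integer coefficients with a polynomially bounded sum of absolute values. The linear
  steps come from relations between the \<open>y\<^sub>L\<close>, multiplied by monomials.

  The only substantial step is contraction, from \<open>y\<^sub>L\<^sup>2 A\<close> to \<open>y\<^sub>L A\<close>. A form \<open>L\<close> of unary size \<open>s\<close>
  takes only values \<open>v\<close> with \<open>\<bar>v\<bar> \<le> s\<close> on Boolean inputs, so the product of the \<open>L - v\<close> vanishes. Expanding it
  would give large polynomials; instead every \<open>L - v\<close> receives its own variable, and the product is a single
  monomial. It is derived by induction on \<open>s\<close>: after multiplication by \<open>x\<close> or by \<open>1 - x\<close>, adding \<open>\<plusminus>x\<close> to
  the form amounts to adding the constant \<open>\<plusminus>1\<close> or \<open>0\<close>, and the factors are replaced one at a time. Modulo \<open>y\<^sub>L\<^sup>2 A\<close>,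
  a factor \<open>L - v\<close> with \<open>v \<noteq> 0\<close> acts on \<open>y\<^sub>L A\<close> as the nonzero constant \<open>-v\<close> and can be cancelled.
\<close>

section \<open>Integer polynomials of bounded norm\<close>

lemma Const_add: "Const (a + b) = Const a + Const b"
  by (simp add: Const_def single_add)

lemma Const_mult: "Const (a * b) = Const a * Const b"
  by (simp add: Const_def mult_single)

lemma Const_0 [simp]: "Const 0 = 0"
  by (simp add: Const_def)

lemma Const_1 [simp]: "Const 1 = 1"
  by (simp add: Const_def)

lemma Const_uminus: "Const (- a) = - Const a"
  by (simp add: Const_def single_uminus)

lemma Const_diff: "Const (a - b) = Const a - Const b"
  by (simp add: Const_def single_diff)

abbreviation mono_prod :: "var list \<Rightarrow> qpoly" where
  "mono_prod vs \<equiv> (\<Prod>v\<leftarrow>vs. Var v)"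

lemma mono_single: "\<exists>m. mono_prod vs = Poly_Mapping.single m 1"
proof (induction vs)
  case Nil
  then show ?case by (metis list.simps(8) prod_list.Nil single_one)
next
  case (Cons v vs)
  then show ?case by (auto simp: Var_def mult_single)
qed

text \<open>An upper bound on the sum of absolute values of the coefficients, all of them integral.
  The summands need not have distinct monomials, so closure under sums and products requires no
  analysis of cancellation, which can only make the true sum smaller.\<close>

inductive norm_le :: "nat \<Rightarrow> qpoly \<Rightarrow> bool" where
  zero: "norm_le N 0"
| step: "norm_le N R \<Longrightarrow> nat \<bar>c\<bar> + N \<le> N' \<Longrightarrow> norm_le N' (Const (of_int c) * mono_prod vs + R)"

lemma norm_le_lookup:
  assumes "norm_le N R"
  shows "Poly_Mapping.lookup R m \<in> \<int>"
    and "finite F \<Longrightarrow> (\<Sum>m\<in>F. \<bar>Poly_Mapping.lookup R m\<bar>) \<le> of_nat N"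
proof -
  have "(\<forall>m. Poly_Mapping.lookup R m \<in> \<int>) \<and> (\<forall>F. finite F \<longrightarrow> (\<Sum>m\<in>F. \<bar>Poly_Mapping.lookup R m\<bar>) \<le> of_nat N)"
    using assms
  proof (induction rule: norm_le.induct)
    case (zero N)
    then show ?case by simp
  next
    case (step N R c N' vs)
    obtain m0 where m0: "mono_prod vs = Poly_Mapping.single m0 1"
      using mono_single by blast
    have l: "Poly_Mapping.lookup (Const (of_int c) * mono_prod vs + R) m
        = (if m = m0 then of_int c else 0) + Poly_Mapping.lookup R m" for m
    proof -
      have "Const (of_int c) * mono_prod vs = Poly_Mapping.single m0 (of_int c)"
        unfolding m0 Const_def mult_single by simp
      then show ?thesis by (simp add: lookup_add lookup_single when_def)
    qed
    have "(\<Sum>m\<in>F. \<bar>Poly_Mapping.lookup (Const (of_int c) * mono_prod vs + R) m\<bar>) \<le> of_nat N'"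
      if F: "finite F" for F
    proof -
      have "(\<Sum>m\<in>F. \<bar>Poly_Mapping.lookup (Const (of_int c) * mono_prod vs + R) m\<bar>)
         \<le> (\<Sum>m\<in>F. (if m = m0 then of_int \<bar>c\<bar> else 0) + \<bar>Poly_Mapping.lookup R m\<bar>)"
        by (intro sum_mono) (auto simp: l intro: order_trans[OF abs_triangle_ineq])
      also have "\<dots> \<le> of_int \<bar>c\<bar> + of_nat N"
        using step.IH F by (auto simp: sum.distrib intro!: add_mono)
      also have "\<dots> = of_nat (nat \<bar>c\<bar> + N)" by simp
      also have "\<dots> \<le> of_nat N'" using step.hyps(2) by (rule of_nat_mono)
      finally show ?thesis .
    qed
    with step.IH show ?case by (simp add: l)
  qed
  then show "Poly_Mapping.lookup R m \<in> \<int>"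
    and "finite F \<Longrightarrow> (\<Sum>m\<in>F. \<bar>Poly_Mapping.lookup R m\<bar>) \<le> of_nat N" by auto
qed

lemma rat_size_int: "rat_size (of_int c) \<le> nat \<bar>c\<bar>"
proof (cases "c = 0")
  case True
  \<comment> \<open>The logarithm of 0 is 0 here, so the coefficient 0 has size 0.\<close>
  have "quotient_of 0 = (0::int, 1)" by (simp add: rat_zero_code)
  with True show ?thesis by (simp add: rat_size_def log_def)
next
  case False
  then have "log 2 (real_of_int \<bar>c\<bar>) \<le> real_of_int \<bar>c\<bar>"
    using log2_of_power_le[of "nat \<bar>c\<bar>" "nat \<bar>c\<bar>"] less_exp[of "nat \<bar>c\<bar>"]
    by (metis abs_ge_zero le_less_linear less_imp_le nat_0_iff of_int_of_nat_eq of_nat_0_le_iff int_nat_eq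
        zero_less_abs_iff zero_less_nat_eq)
  moreover have "quotient_of (of_int c) = (c, 1)"
    by (rule quotient_of_int[unfolded Rat.of_int_def])
  ultimately show ?thesis
    by (simp add: rat_size_def nat_le_eq_zle)
qed

text \<open>An integer coefficient has denominator 1, and its bit size is at most its absolute
  value. This coarse estimate suffices because all norms will be polynomially bounded.\<close>

lemma qpoly_size_le:
  assumes "norm_le N R"
  shows "qpoly_size R \<le> N"
proof -
  have "rat_of_nat (qpoly_size R) \<le> (\<Sum>m\<in>Poly_Mapping.keys R. \<bar>Poly_Mapping.lookup R m\<bar>)"
    unfolding qpoly_size_def of_nat_sum
  proof (rule sum_mono)
    fix m
    obtain c where c: "Poly_Mapping.lookup R m = of_int c"
      using norm_le_lookup(1)[OF assms, of m] by (auto elim: Ints_cases)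
    have "rat_of_nat (rat_size (of_int c)) \<le> of_nat (nat \<bar>c\<bar>)"
      using rat_size_int by (rule of_nat_mono)
    then show "rat_of_nat (rat_size (Poly_Mapping.lookup R m)) \<le> \<bar>Poly_Mapping.lookup R m\<bar>"
      by (simp add: c)
  qed
  also have "\<dots> \<le> of_nat N"
    using norm_le_lookup(2)[OF assms] by simp
  finally show ?thesis by simp
qed

lemma norm_le_mono: "norm_le N R \<Longrightarrow> N \<le> N' \<Longrightarrow> norm_le N' R"
  by (induction rule: norm_le.induct) (auto intro: norm_le.intros)

lemma norm_le_add:
  assumes "norm_le N R" "norm_le N' S" "N + N' \<le> M"
  shows "norm_le M (R + S)"
  using assms
proof (induction arbitrary: M rule: norm_le.induct)
  case (zero N)
  then show ?case by (simp add: norm_le_mono)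
next
  case (step N R c N1 vs)
  show ?case
    using norm_le.step[OF step.IH[OF step.prems(1) order_refl], of c M vs] step.hyps step.prems
    by (simp add: add.assoc)
qed

lemma norm_le_monomial: "norm_le (nat \<bar>c\<bar>) (Const (of_int c) * mono_prod vs)"
  using norm_le.step[OF norm_le.zero[of 0], of c] by simp

lemma norm_le_mult:
  assumes "norm_le N R" "norm_le N' S"
  shows "norm_le (N * N') (R * S)"
proof -
  have *: "norm_le (nat \<bar>c\<bar> * N') (Const (of_int c) * mono_prod vs * S)" for c vs
    using assms(2)
  proof (induction rule: norm_le.induct)
    case (zero N)
    then show ?case by (simp add: norm_le.zero)
  next
    case (step N R d N1 ws)
    have "Const (of_int c) * mono_prod vs * (Const (of_int d) * mono_prod ws + R)
       = Const (of_int (c * d)) * mono_prod (vs @ ws) + Const (of_int c) * mono_prod vs * R"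
      by (simp add: Const_mult algebra_simps)
    moreover have "nat \<bar>c * d\<bar> + nat \<bar>c\<bar> * N = nat \<bar>c\<bar> * (nat \<bar>d\<bar> + N)"
      by (simp add: abs_mult nat_mult_distrib algebra_simps)
    ultimately show ?case
      using norm_le.step[OF step.IH, of "c * d" "nat \<bar>c\<bar> * N1" "vs @ ws"] step.hyps
      by (simp only: mult_le_mono2)
  qed
  show ?thesis
    using assms(1)
  proof (induction rule: norm_le.induct)
    case (zero N)
    then show ?case by (simp add: norm_le.zero)
  next
    case (step N R c N1 vs)
    then show ?case
      using norm_le_add[OF *[of c vs] step.IH, of "N1 * N'"] mult_le_mono1[OF step.hyps(2), of N']
      by (simp add: algebra_simps)
  qed
qed

lemma norm_le_Const: "nat \<bar>c\<bar> \<le> N \<Longrightarrow> norm_le N (Const (of_int c))"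
  using norm_le_monomial[of c "[]"] by (auto intro: norm_le_mono)

lemma norm_le_mono1: "1 \<le> N \<Longrightarrow> norm_le N (mono_prod vs)"
  using norm_le_monomial[of 1 vs] by (auto intro: norm_le_mono)

lemma norm_le_scale:
  "norm_le N R \<Longrightarrow> nat \<bar>c\<bar> * N \<le> M \<Longrightarrow> norm_le M (Const (of_int c) * R)"
  using norm_le_mult[OF norm_le_Const[OF order_refl]] norm_le_mono by blast

lemma norm_le_uminus: "norm_le N R \<Longrightarrow> norm_le N (- R)"
  using norm_le_scale[of N R "-1" N] by (simp add: Const_uminus)

lemma norm_le_diff:
  "norm_le N R \<Longrightarrow> norm_le N' S \<Longrightarrow> N + N' \<le> M \<Longrightarrow> norm_le M (R - S)"
  using norm_le_add[of N R N' "- S"] norm_le_uminus by simp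

lemma norm_le_Var: "1 \<le> N \<Longrightarrow> norm_le N (Var v)"
  using norm_le_mono1[of N "[v]"] by simp

lemma norm_le_1: "1 \<le> N \<Longrightarrow> norm_le N 1"
  using norm_le_mono1[of N "[]"] by simp

lemma norm_le_sum:
  assumes "finite I" "\<And>i. i \<in> I \<Longrightarrow> norm_le (f i) (g i)"
  shows "norm_le (\<Sum>i\<in>I. f i) (\<Sum>i\<in>I. g i)"
  using assms by (induction I rule: finite_induct) (auto intro: norm_le_add norm_le.zero)

section \<open>Products of variables and their degrees\<close>

definition monomial :: "nat \<Rightarrow> qpoly \<Rightarrow> bool" where
  "monomial d P \<longleftrightarrow> (\<exists>vs. length vs = d \<and> P = mono_prod vs)"

lemma monomial_1: "monomial 0 1" by (auto simp: monomial_def)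

lemma monomial_mult: "monomial d P \<Longrightarrow> monomial e Q \<Longrightarrow> monomial (d + e) (P * Q)"
  unfolding monomial_def by (metis length_append map_append prod_list.append)

lemma monomial_Var: "monomial 1 (Var v)"
  unfolding monomial_def by (rule exI[of _ "[v]"]) simp

lemma monomial_prod: "finite I \<Longrightarrow> monomial (card I) (\<Prod>i\<in>I. Var (f i))"
  by (induction I rule: finite_induct)
    (use monomial_mult[OF monomial_Var] in \<open>auto simp: monomial_1\<close>)

lemma monomial_prod_mset: "monomial (size A) (\<Prod>L\<in>#A. Var (f L))"
  by (induction A) (use monomial_mult[OF monomial_Var] in \<open>auto simp: monomial_1\<close>)

lemma norm_le_monomial1: "monomial d P \<Longrightarrow> 1 \<le> N \<Longrightarrow> norm_le N P"
  by (auto simp: monomial_def norm_le_mono1)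

lemma norm_le_monomial_mult: "monomial d P \<Longrightarrow> norm_le N R \<Longrightarrow> norm_le N (P * R)"
  using norm_le_mult[OF norm_le_monomial1[of d P 1]] by simp

text \<open>Numerator and denominator are both 1, with logarithm 0. The norm bound 1 would not be
  enough for lines that contain the zero form, since the proof size does not control how many
  disjuncts they have.\<close>

lemma qpoly_size_monomial: "monomial d P \<Longrightarrow> qpoly_size P = 0"
proof -
  assume "monomial d P"
  then obtain m where "P = Poly_Mapping.single m 1"
    using mono_single unfolding monomial_def by blast
  moreover have "quotient_of 1 = (1::int, 1)" by (simp add: rat_one_code)
  ultimately show ?thesis by (simp add: qpoly_size_def rat_size_def)
qed

section \<open>Derivations of bounded length and norm\<close>

lemma pc_step_mono: "pc_step P R \<Longrightarrow> P \<subseteq> P' \<Longrightarrow> pc_step P' R"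
  by (induction rule: pc_step.induct) (auto intro: pc_step.intros)

lemma pc_step_refl: "R \<in> P \<Longrightarrow> pc_step P R"
  using pc_step.combination[of R P R 1 0] by simp

text \<open>A line of \<open>\<rho>\<close> that \<open>\<rho>'\<close> uses as an axiom is
  justified as the combination of itself with coefficients 1 and 0, so the concatenation needs no
  further line.\<close>

lemma pc_derivation_append:
  assumes "pc_derivation \<Gamma> \<rho>" "pc_derivation (\<Gamma> \<union> set \<rho>) \<rho>'"
  shows "pc_derivation \<Gamma> (\<rho> @ \<rho>')"
  unfolding pc_derivation_def
proof (intro allI impI)
  fix i assume i: "i < length (\<rho> @ \<rho>')"
  show "(\<rho> @ \<rho>') ! i \<in> \<Gamma> \<or> pc_step (set (take i (\<rho> @ \<rho>'))) ((\<rho> @ \<rho>') ! i)"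
  proof (cases "i < length \<rho>")
    case True
    then show ?thesis using assms(1) by (auto simp: pc_derivation_def nth_append)
  next
    case False
    let ?j = "i - length \<rho>"
    have "?j < length \<rho>'" using i False by simp
    with assms(2) have "\<rho>' ! ?j \<in> \<Gamma> \<union> set \<rho> \<or> pc_step (set (take ?j \<rho>')) (\<rho>' ! ?j)"
      by (simp add: pc_derivation_def)
    moreover have "set (take i (\<rho> @ \<rho>')) = set \<rho> \<union> set (take ?j \<rho>')"
      using False by simp
    ultimately show ?thesis
      using False by (auto simp: nth_append intro: pc_step_mono pc_step_refl)
  qed
qed

lemma pc_derivation_snoc:
  assumes "pc_derivation \<Gamma> \<rho>" "R \<in> \<Gamma> \<or> pc_step (set \<rho>) R"
  shows "pc_derivation \<Gamma> (\<rho> @ [R])"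
  using assms by (auto simp: pc_derivation_def nth_append less_Suc_eq)

lemma pc_derivation_mono: "pc_derivation \<Gamma> \<rho> \<Longrightarrow> \<Gamma> \<subseteq> \<Gamma>' \<Longrightarrow> pc_derivation \<Gamma>' \<rho>"
  by (auto simp: pc_derivation_def)

text \<open>Length and line norm are kept apart: under a common \<open>N\<close>, concatenation just
  adds lengths, and at the end the product of the two bounds the size.\<close>

definition derives :: "nat \<Rightarrow> qpoly set \<Rightarrow> nat \<Rightarrow> qpoly \<Rightarrow> bool" where
  "derives N \<Gamma> k R \<longleftrightarrow> (\<exists>\<rho>. pc_derivation \<Gamma> \<rho> \<and> R \<in> set \<rho> \<and> length \<rho> \<le> k \<and> (\<forall>S\<in>set \<rho>. norm_le N S))"

lemma derives_mono:
  "derives N \<Gamma> k R \<Longrightarrow> \<Gamma> \<subseteq> \<Gamma>' \<Longrightarrow> k \<le> k' \<Longrightarrow> derives N \<Gamma>' k' R"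
  unfolding derives_def by (meson le_trans pc_derivation_mono)

lemma derives_le: "derives N \<Gamma> k R \<Longrightarrow> k \<le> k' \<Longrightarrow> derives N \<Gamma> k' R"
  by (rule derives_mono) auto

lemma derives_axiom: "R \<in> \<Gamma> \<Longrightarrow> norm_le N R \<Longrightarrow> derives N \<Gamma> 1 R"
  unfolding derives_def by (rule exI[of _ "[R]"]) (simp add: pc_derivation_def)

lemma derives_combination:
  assumes "derives N \<Gamma> k R" "derives N \<Gamma> l S"
    and T: "T = Const a * R + Const b * S" "norm_le N T"
  shows "derives N \<Gamma> (k + l + 1) T"
proof -
  obtain \<rho> \<sigma> where \<rho>: "pc_derivation \<Gamma> \<rho>" "R \<in> set \<rho>" "length \<rho> \<le> k" "\<forall>S\<in>set \<rho>. norm_le N S"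
    and \<sigma>: "pc_derivation \<Gamma> \<sigma>" "S \<in> set \<sigma>" "length \<sigma> \<le> l" "\<forall>S\<in>set \<sigma>. norm_le N S"
    using assms(1,2) unfolding derives_def by blast
  have "pc_derivation \<Gamma> (\<rho> @ \<sigma>)"
    using \<rho>(1) \<sigma>(1) by (intro pc_derivation_append) (auto intro: pc_derivation_mono)
  then have "pc_derivation \<Gamma> ((\<rho> @ \<sigma>) @ [T])"
    unfolding T(1) using \<rho>(2) \<sigma>(2) by (intro pc_derivation_snoc disjI2 pc_step.combination) auto
  then show ?thesis
    unfolding derives_def using \<rho> \<sigma> T(2) by (intro exI[of _ "(\<rho> @ \<sigma>) @ [T]"]) auto
qed

text \<open>The scalar does not count in the size, only the resulting line does. Division by a
  nonzero integer therefore costs one line whenever the quotient is again integral.\<close>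

lemma derives_scaled:
  assumes "derives N \<Gamma> k R" "T = Const a * R" "norm_le N T"
  shows "derives N \<Gamma> (k + 1) T"
proof -
  obtain \<rho> where \<rho>: "pc_derivation \<Gamma> \<rho>" "R \<in> set \<rho>" "length \<rho> \<le> k" "\<forall>S\<in>set \<rho>. norm_le N S"
    using assms(1) unfolding derives_def by blast
  have "pc_step (set \<rho>) T"
    using pc_step.combination[OF \<rho>(2) \<rho>(2), of a 0] assms(2) by simp
  then show ?thesis
    unfolding derives_def using \<rho> assms(3) pc_derivation_snoc[OF \<rho>(1), of T]
    by (intro exI[of _ "\<rho> @ [T]"]) auto
qed

lemma derives_Var:
  assumes "derives N \<Gamma> k R"
  shows "derives N \<Gamma> (k + 1) (Var v * R)"
proof -
  obtain \<rho> where \<rho>: "pc_derivation \<Gamma> \<rho>" "R \<in> set \<rho>" "length \<rho> \<le> k" "\<forall>S\<in>set \<rho>. norm_le N S"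
    using assms unfolding derives_def by blast
  show ?thesis
    unfolding derives_def
    using \<rho> pc_derivation_snoc[OF \<rho>(1) disjI2[OF pc_step.multiplication[OF \<rho>(2)]], of v]
      norm_le_monomial_mult[OF monomial_Var[of v], of N R]
    by (intro exI[of _ "\<rho> @ [Var v * R]"]) auto
qed

lemma derives_monomial_mult:
  assumes "derives N \<Gamma> k R" "monomial d P"
  shows "derives N \<Gamma> (k + d) (P * R)"
proof -
  have "derives N \<Gamma> (k + length vs) (mono_prod vs * R)" for vs
  proof (induction vs)
    case (Cons v vs)
    then show ?case using derives_Var[OF Cons, of v] by (simp add: mult.assoc)
  qed (use assms in simp)
  with assms(2) show ?thesis by (auto simp: monomial_def)
qed

lemma derives_cut:
  assumes "derives N \<Gamma> k R" "derives N (insert R \<Gamma>) l S"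
  shows "derives N \<Gamma> (k + l) S"
proof -
  obtain \<rho> \<sigma> where \<rho>: "pc_derivation \<Gamma> \<rho>" "R \<in> set \<rho>" "length \<rho> \<le> k" "\<forall>S\<in>set \<rho>. norm_le N S"
    and \<sigma>: "pc_derivation (insert R \<Gamma>) \<sigma>" "S \<in> set \<sigma>" "length \<sigma> \<le> l" "\<forall>S\<in>set \<sigma>. norm_le N S"
    using assms(1,2) unfolding derives_def by blast
  have "pc_derivation \<Gamma> (\<rho> @ \<sigma>)"
    using \<rho>(1,2) \<sigma>(1) by (intro pc_derivation_append) (auto intro: pc_derivation_mono)
  then show ?thesis
    unfolding derives_def using \<rho> \<sigma> by (intro exI[of _ "\<rho> @ \<sigma>"]) auto
qed

text \<open>Each replacement adds a monomial multiple of one relation. The factor \<open>q\<close>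
  will be \<open>x\<close> or \<open>1 - x\<close>; as the latter is not a monomial,
  \<open>q\<close> is built into the relations and never multiplied on afterwards.\<close>

lemma derives_replace:
  assumes I: "finite I" and q: "norm_le N q"
    and rel: "\<And>i. i \<in> I \<Longrightarrow> derives N \<Gamma> k (q * (Var (f i) - Var (g i)))"
    and P: "monomial d P"
    and start: "derives N \<Gamma> l (q * (\<Prod>i\<in>I. Var (g i)) * P)"
  shows "derives N \<Gamma> (l + card I * (k + card I + d + 1)) (q * (\<Prod>i\<in>I. Var (f i)) * P)"
  using I rel P start
proof (induction I arbitrary: l d P rule: finite_induct)
  case empty
  then show ?case by simp
next
  case (insert i I)
  let ?g = "\<Prod>i\<in>I. Var (g i)" and ?f = "\<Prod>i\<in>I. Var (f i)"
  have mon: "monomial (card I + d) (?g * P)"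
    by (intro monomial_mult monomial_prod insert)
  have 1: "derives N \<Gamma> (k + (card I + d)) (?g * P * (q * (Var (f i) - Var (g i))))"
    by (intro derives_monomial_mult insert.prems mon) simp
  \<comment> \<open>The factor already replaced moves into the context \<open>P\<close>, whose
    degree grows by one.\<close>
  have mon': "monomial (d + 1) (Var (f i) * P)"
    using monomial_mult[OF monomial_Var insert.prems(2), of "f i"] by simp
  have 2: "derives N \<Gamma> (k + (card I + d) + l + 1) (q * ?g * (Var (f i) * P))"
  proof (rule derives_combination[OF 1 insert.prems(3), of _ 1 1])
    show "q * ?g * (Var (f i) * P) = Const 1 * (?g * P * (q * (Var (f i) - Var (g i))))
        + Const 1 * (q * (\<Prod>i\<in>insert i I. Var (g i)) * P)"
      using insert.hyps by (simp add: algebra_simps)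
    have "norm_le N (?g * (Var (f i) * P) * q)"
      by (rule norm_le_monomial_mult[OF monomial_mult[OF monomial_prod[OF insert.hyps(1)] mon'] q])
    then show "norm_le N (q * ?g * (Var (f i) * P))" by (simp add: mult_ac)
  qed
  have "derives N \<Gamma> (k + (card I + d) + l + 1 + card I * (k + card I + (d + 1) + 1))
      (q * ?f * (Var (f i) * P))"
    by (rule insert.IH[OF _ mon' 2]) (use insert.prems in auto)
  moreover have "q * ?f * (Var (f i) * P) = q * (\<Prod>i\<in>insert i I. Var (f i)) * P"
    using insert.hyps by (simp add: mult_ac)
  moreover have "k + (card I + d) + l + 1 + card I * (k + card I + (d + 1) + 1)
      \<le> l + card (insert i I) * (k + card (insert i I) + d + 1)"
    using insert.hyps by (simp add: algebra_simps)
  ultimately show ?case by (simp only: derives_le)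
qed

section \<open>Relations between the variables of affine forms\<close>

abbreviation yvar :: "affine \<Rightarrow> qpoly" where
  "yvar L \<equiv> Var (Y L)"

definition lin :: "nat \<Rightarrow> affine \<Rightarrow> qpoly" where
  "lin n L = affine_poly n (\<lambda>i. of_int (Poly_Mapping.lookup L i))"

text \<open>All defining axioms at once, so that the simulation need not keep track of which forms
  occur. The finitely many that are used are singled out in
  \<open>sps_pc_derivationI\<close>.\<close>

definition form_axioms :: "nat \<Rightarrow> qpoly set" where
  "form_axioms n = range (\<lambda>L. yvar L - lin n L)"

lemma affine_poly_add: "affine_poly n (\<lambda>i. a i + b i) = affine_poly n a + affine_poly n b"
  by (simp add: affine_poly_def Const_add algebra_simps sum.distrib)

lemma affine_poly_scale: "affine_poly n (\<lambda>i. c * a i) = Const c * affine_poly n a"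
  by (simp add: affine_poly_def Const_mult algebra_simps sum_distrib_left)

lemma affine_poly_combination:
  assumes "\<And>i. d * Poly_Mapping.lookup M i = a * Poly_Mapping.lookup L1 i + b * Poly_Mapping.lookup L2 i"
  shows "Const (of_int d) * lin n M = Const (of_int a) * lin n L1 + Const (of_int b) * lin n L2"
proof -
  have "rat_of_int d * of_int (Poly_Mapping.lookup M i)
      = of_int a * of_int (Poly_Mapping.lookup L1 i) + of_int b * of_int (Poly_Mapping.lookup L2 i)" for i
    using assms[of i] by (metis of_int_add of_int_mult)
  then show ?thesis
    by (simp only: lin_def flip: affine_poly_scale affine_poly_add)
qed

lemma lin_diff: "lin n (L - M) = lin n L - lin n M"
  using affine_poly_combination[of 1 "L - M" 1 L "-1" M n]
  by (simp add: lookup_minus Const_uminus)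

lemma lin_const: "lin n (Poly_Mapping.single 0 k) = Const (of_int k)"
proof -
  have "(\<Sum>j = 1..n. Const (rat_of_int (k when 0 = j)) * Var (X j)) = 0"
    by (intro sum.neutral) auto
  then show ?thesis
    by (simp add: lin_def affine_poly_def lookup_single)
qed

lemma lin_single:
  assumes "h \<in> {1..n}"
  shows "lin n (Poly_Mapping.single h c) = Const (of_int c) * Var (X h)"
proof -
  have "(\<Sum>j = 1..n. Const (rat_of_int (c when h = j)) * Var (X j))
      = (\<Sum>j = 1..n. if h = j then Const (of_int c) * Var (X j) else 0)"
    by (intro sum.cong) (auto simp: when_def)
  then show ?thesis
    using assms by (simp add: lin_def affine_poly_def lookup_single)
qed

section \<open>Unary size of affine forms and norm of their polynomials\<close>

lemma affine_size_superset:
  assumes "finite I" "Poly_Mapping.keys L \<subseteq> I"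
  shows "affine_size L = (\<Sum>i\<in>I. nat \<bar>Poly_Mapping.lookup L i\<bar>)"
  unfolding affine_size_def using assms
  by (intro sum.mono_neutral_left) (auto simp: in_keys_iff)

lemma affine_size_diff: "affine_size (L - M) \<le> affine_size L + affine_size M"
proof -
  let ?I = "Poly_Mapping.keys L \<union> Poly_Mapping.keys M"
  have "affine_size (L - M) = (\<Sum>i\<in>?I. nat \<bar>Poly_Mapping.lookup (L - M) i\<bar>)"
    by (intro affine_size_superset) (auto simp: in_keys_iff lookup_minus)
  also have "\<dots> \<le> (\<Sum>i\<in>?I. nat \<bar>Poly_Mapping.lookup L i\<bar> + nat \<bar>Poly_Mapping.lookup M i\<bar>)"
    by (intro sum_mono) (auto simp: lookup_minus)
  also have "\<dots> = affine_size L + affine_size M"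
    by (simp add: sum.distrib affine_size_superset[of ?I])
  finally show ?thesis .
qed

lemma affine_size_single: "affine_size (Poly_Mapping.single h c) = nat \<bar>c\<bar>"
  by (simp add: affine_size_superset[of "{h}"])

lemma affine_size_lookup: "\<bar>Poly_Mapping.lookup L i\<bar> \<le> int (affine_size L)"
proof (cases "i \<in> Poly_Mapping.keys L")
  case True
  then have "nat \<bar>Poly_Mapping.lookup L i\<bar> \<le> affine_size L"
    unfolding affine_size_def by (intro member_le_sum) auto
  then show ?thesis by simp
qed (simp add: in_keys_iff)

lemma affine_size_eq_0: "affine_size L = 0 \<longleftrightarrow> L = 0"
  by (auto simp: affine_size_def in_keys_iff intro!: poly_mapping_eqI)

lemma norm_le_lin: "norm_le (affine_size L) (lin n L)"
proof -
  let ?a = "\<lambda>j. rat_of_int (Poly_Mapping.lookup L j)"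
  have "norm_le (\<Sum>j=1..n. nat \<bar>Poly_Mapping.lookup L j\<bar>) (\<Sum>j=1..n. Const (?a j) * Var (X j))"
    by (intro norm_le_sum norm_le_scale[OF norm_le_Var[of 1]]) auto
  then have "norm_le (nat \<bar>Poly_Mapping.lookup L 0\<bar> + (\<Sum>j=1..n. nat \<bar>Poly_Mapping.lookup L j\<bar>)) (lin n L)"
    unfolding lin_def affine_poly_def by (intro norm_le_add[OF norm_le_Const]) auto
  moreover have "nat \<bar>Poly_Mapping.lookup L 0\<bar> + (\<Sum>j=1..n. nat \<bar>Poly_Mapping.lookup L j\<bar>)
      = (\<Sum>j\<in>{0..n}. nat \<bar>Poly_Mapping.lookup L j\<bar>)"
    by (simp add: sum.atLeast_Suc_atMost)
  \<comment> \<open>Indices above \<open>n\<close> do not contribute to \<open>lin n L\<close>;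
    adding them only weakens the bound.\<close>
  moreover have "\<dots> \<le> (\<Sum>j\<in>{0..n} \<union> Poly_Mapping.keys L. nat \<bar>Poly_Mapping.lookup L j\<bar>)"
    by (intro sum_mono2) auto
  moreover have "\<dots> = affine_size L"
    by (intro affine_size_superset[symmetric]) auto
  ultimately show ?thesis by (metis norm_le_mono)
qed

lemma norm_le_form_axiom: "affine_size L < N \<Longrightarrow> norm_le N (yvar L - lin n L)"
  by (intro norm_le_diff[OF norm_le_Var[of 1] norm_le_lin]) auto

section \<open>Short derivations of linear relations\<close>

lemma derives_form_axiom:
  assumes "form_axioms n \<subseteq> \<Gamma>" "affine_size L < N"
  shows "derives N \<Gamma> 1 (yvar L - lin n L)"
  using assms by (intro derives_axiom norm_le_form_axiom) (auto simp: form_axioms_def)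

lemma derives_form_diff:
  assumes "form_axioms n \<subseteq> \<Gamma>" "affine_size L \<le> s" "affine_size M \<le> s" "2 * s + 2 \<le> N"
  shows "derives N \<Gamma> 3 (yvar L - yvar M - lin n (L - M))"
proof -
  have ax: "derives N \<Gamma> 1 (yvar L - lin n L)" "derives N \<Gamma> 1 (yvar M - lin n M)"
    using assms by (auto intro!: derives_form_axiom simp del: One_nat_def)
  have "derives N \<Gamma> (1 + 1 + 1) (yvar L - yvar M - lin n (L - M))"
  proof (rule derives_combination[OF ax, of _ 1 "-1"])
    show "yvar L - yvar M - lin n (L - M) = Const 1 * (yvar L - lin n L) + Const (-1) * (yvar M - lin n M)"
      by (simp add: lin_diff Const_uminus)
    have "affine_size (L - M) \<le> 2 * s"
      using affine_size_diff[of L M] assms by linarith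
    then show "norm_le N (yvar L - yvar M - lin n (L - M))"
      using assms(4)
      by (intro norm_le_diff[OF norm_le_diff[OF norm_le_Var[of 1] norm_le_Var[of 1] order_refl] norm_le_lin])
         auto
  qed
  then show ?thesis by (simp add: numeral_3_eq_3)
qed

text \<open>The linear parts of the three scaled axioms cancel by \<open>rel\<close>. They cancel
  only in the second combination, so the intermediate line still carries them; each scaled axiom has
  norm at most \<open>t * (s + 1)\<close>, which explains the bound on \<open>N\<close>.\<close>

lemma derives_linear_relation:
  assumes rel: "\<And>i. d * Poly_Mapping.lookup M i = a * Poly_Mapping.lookup L1 i + b * Poly_Mapping.lookup L2 i"
    and ax: "form_axioms n \<subseteq> \<Gamma>"
    and s: "affine_size M \<le> s" "affine_size L1 \<le> s" "affine_size L2 \<le> s"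
    and t: "\<bar>d\<bar> \<le> int t" "\<bar>a\<bar> \<le> int t" "\<bar>b\<bar> \<le> int t" "1 \<le> t" and N: "3 * t * (s + 1) \<le> N"
  shows "derives N \<Gamma> 5 (Const (of_int d) * yvar M - Const (of_int a) * yvar L1 - Const (of_int b) * yvar L2)"
proof -
  have "1 * (s + 1) \<le> 3 * t * (s + 1)" using t(4) by (intro mult_le_mono1) simp
  then have sN: "s + 1 \<le> N" using N by simp
  have d1: "derives N \<Gamma> 1 (yvar L - lin n L)" if "affine_size L \<le> s" for L
    using that ax sN by (auto intro!: derives_form_axiom simp del: One_nat_def)
  have n1: "norm_le (t * (s + 1)) (Const (of_int c) * (yvar L - lin n L))"
    if "affine_size L \<le> s" "\<bar>c\<bar> \<le> int t" for c L
    using that by (intro norm_le_scale[OF norm_le_form_axiom[of L "s+1"]] mult_le_mono1) auto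
  define T where "T = Const (of_int d) * (yvar M - lin n M) - Const (of_int a) * (yvar L1 - lin n L1)"
  have nT: "norm_le (2 * t * (s + 1)) T"
    unfolding T_def by (intro norm_le_diff[OF n1 n1]) (use s t in auto)
  have T: "derives N \<Gamma> (1 + 1 + 1) T"
  proof (rule derives_combination[OF d1 d1, of M L1 T "of_int d" "- of_int a"])
    show "norm_le N T" by (rule norm_le_mono[OF nT]) (use N in simp)
  qed (use s in \<open>auto simp: T_def Const_uminus\<close>)
  define U where "U = Const (of_int d) * yvar M - Const (of_int a) * yvar L1 - Const (of_int b) * yvar L2"
  have U: "U = T - Const (of_int b) * (yvar L2 - lin n L2)"
    using affine_poly_combination[OF rel, of n] by (simp add: U_def T_def algebra_simps)
  have "derives N \<Gamma> ((1 + 1 + 1) + 1 + 1) U"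
  proof (rule derives_combination[OF T d1, of L2 U 1 "- of_int b"])
    show "norm_le N U" unfolding U
      by (rule norm_le_diff[OF nT n1]) (use N s t in \<open>auto simp: algebra_simps\<close>)
  qed (use s in \<open>auto simp: U Const_uminus\<close>)
  then show ?thesis by (simp add: U_def eval_nat_numeral)
qed

section \<open>Simulation of the inference rules\<close>

definition shift :: "affine \<Rightarrow> int \<Rightarrow> affine" where
  "shift L v = L - Poly_Mapping.single 0 v"

definition value_prod :: "affine \<Rightarrow> nat \<Rightarrow> qpoly" where
  "value_prod L s = (\<Prod>v\<in>{- int s..int s}. yvar (shift L v))"

lemma affine_size_shift: "\<bar>v\<bar> \<le> int s \<Longrightarrow> affine_size (shift L v) \<le> affine_size L + s"
  using affine_size_diff[of L "Poly_Mapping.single 0 v"] by (simp add: shift_def affine_size_single)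

lemma lin_shift_diff: "lin n (shift L v - shift M w) = lin n (L - M) - Const (of_int (v - w))"
  by (simp add: shift_def lin_diff lin_const Const_diff)

text \<open>For the induction step: of the \<open>2 * s + 3\<close> factors of the product for
  \<open>s + 1\<close>, a block of \<open>2 * s + 1\<close> is matched with the factors of the
  smaller form, and the two left over are multiplied on as a monomial.\<close>

lemma value_prod_factor:
  assumes "J \<subseteq> {- int s..int s}"
  obtains P where "monomial (2 * s + 1 - card J) P" "value_prod L s = P * (\<Prod>v\<in>J. yvar (shift L v))"
proof
  have fin: "finite J" using assms finite_subset by blast
  have "card ({- int s..int s} - J) = 2 * s + 1 - card J"
    using assms fin by (simp add: card_Diff_subset nat_add_distrib nat_mult_distrib)
  then show "monomial (2 * s + 1 - card J) (\<Prod>v\<in>{- int s..int s} - J. yvar (shift L v))"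
    using monomial_prod[of "{- int s..int s} - J" "\<lambda>v. Y (shift L v)"] by simp
  show "value_prod L s = (\<Prod>v\<in>{- int s..int s} - J. yvar (shift L v)) * (\<Prod>v\<in>J. yvar (shift L v))"
    unfolding value_prod_def by (intro prod.subset_diff assms) simp
qed

lemma derives_boolean:
  assumes "bool_polys n \<subseteq> \<Gamma>" "h \<in> {1..n}" "2 \<le> N"
  shows "derives N \<Gamma> 1 (Var (X h) * Var (X h) - Var (X h))"
proof (rule derives_axiom)
  show "Var (X h) * Var (X h) - Var (X h) \<in> \<Gamma>"
    using assms unfolding bool_polys_def power2_eq_square by auto
  show "norm_le N (Var (X h) * Var (X h) - Var (X h))"
    using norm_le_mono1[of 1 "[X h, X h]"] assms(3)
    by (intro norm_le_diff[OF _ norm_le_Var[of 1], of 1]) auto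
qed

text \<open>If \<open>x_h = 1\<close>, then \<open>L - (v + \<sigma>)\<close> equals
  \<open>L0 - v\<close>; if \<open>x_h = 0\<close>, then \<open>L - v\<close> does. Multiplication
  by \<open>x\<close> and by \<open>1 - x\<close> expresses these two cases, and the two results add
  up to the claim.\<close>

lemma derives_value_prod_step:
  fixes L0 :: affine and \<sigma> :: int and h :: nat
  defines "L \<equiv> L0 + Poly_Mapping.single h \<sigma>"
  assumes ax: "form_axioms n \<subseteq> \<Gamma>" "bool_polys n \<subseteq> \<Gamma>"
    and h: "h \<in> {0..n}" and \<sigma>: "\<bar>\<sigma>\<bar> = 1"
    and size: "affine_size L0 \<le> s" "affine_size L \<le> s + 1" and N: "6 * s + 8 \<le> N"
    and start: "value_prod L0 s \<in> \<Gamma>"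
  shows "derives N \<Gamma> (2 * (2 * s + 1) * (2 * s + 12) + 13) (value_prod L (s + 1))"
proof -
  let ?I = "{- int s..int s}"
  let ?J = "(\<lambda>v. v + \<sigma>) ` ?I"
  have cI: "card ?I = 2 * s + 1" by (simp add: nat_add_distrib nat_mult_distrib)
  have cJ: "card ?J = 2 * s + 1" using cI by (simp add: card_image inj_on_def)
  have "norm_le N (value_prod L0 s)"
    unfolding value_prod_def
    by (rule norm_le_monomial1[OF monomial_prod]) (use N in auto)
  with start have st: "derives N \<Gamma> 1 (value_prod L0 s)" by (rule derives_axiom)
  have "?J \<subseteq> {- int (s + 1)..int (s + 1)}" using \<sigma> by auto
  then obtain P where P: "monomial (2 * (s + 1) + 1 - card ?J) P"
      "value_prod L (s + 1) = P * (\<Prod>v\<in>?J. yvar (shift L v))"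
    by (rule value_prod_factor)
  moreover have "(\<Prod>v\<in>?J. yvar (shift L v)) = (\<Prod>v\<in>?I. yvar (shift L (v + \<sigma>)))"
    by (subst prod.reindex) (simp_all add: inj_on_def del: image_add_atLeastAtMost')
  moreover have "2 * (s + 1) + 1 - card ?J = 2" unfolding cJ by simp
  ultimately have P: "monomial 2 P" "value_prod L (s + 1) = P * (\<Prod>v\<in>?I. yvar (shift L (v + \<sigma>)))"
    by simp_all
  have "?I \<subseteq> {- int (s + 1)..int (s + 1)}" by auto
  then obtain Q where Q: "monomial (2 * (s + 1) + 1 - card ?I) Q"
      "value_prod L (s + 1) = Q * (\<Prod>v\<in>?I. yvar (shift L v))"
    by (rule value_prod_factor)
  moreover have "2 * (s + 1) + 1 - card ?I = 2" unfolding cI by simp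
  ultimately have Q: "monomial 2 Q" "value_prod L (s + 1) = Q * (\<Prod>v\<in>?I. yvar (shift L v))"
    by simp_all
  show ?thesis
  proof (cases "h = 0")
    case True
    \<comment> \<open>The constant term changes by \<open>\<sigma>\<close>: both shifts are the same
      form and hence share a variable, so nothing has to be replaced.\<close>
    then have "shift L (v + \<sigma>) = shift L0 v" for v
      by (simp add: L_def shift_def single_add)
    with P(2) have "value_prod L (s + 1) = P * value_prod L0 s"
      by (simp add: value_prod_def)
    then show ?thesis
      using derives_monomial_mult[OF st P(1)] by (auto elim: derives_le)
  next
    case False
    with h have h: "h \<in> {1..n}" by auto
    let ?x = "Var (X h)"
    have N8: "8 \<le> N" "2 * (3 * s + 2) + 2 \<le> N" using N by auto
    have bool: "derives N \<Gamma> 1 (?x * ?x - ?x)"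
      using ax(2) h N8 by (intro derives_boolean) auto
    have lin: "lin n (L - L0) = Const (of_int \<sigma>) * ?x"
      by (simp add: L_def lin_single[OF h])
    have nx: "norm_le 1 ?x" by (simp add: norm_le_Var)
    have n\<sigma>: "norm_le 1 (Const (of_int \<sigma>) * ?x)"
      using \<sigma> by (intro norm_le_scale[OF nx]) auto
    have nb: "norm_le 2 (yvar A - yvar B)" for A B
      by (intro norm_le_diff[OF norm_le_Var[of 1] norm_le_Var[of 1]]) auto
    have n1x: "norm_le 2 (1 - ?x)"
      by (intro norm_le_diff[OF norm_le_1[of 1] nx]) auto
    have diff: "derives N \<Gamma> 3 (yvar (shift L w) - yvar (shift L0 v)
        - (Const (of_int \<sigma>) * ?x - Const (of_int (w - v))))"
      if "v \<in> ?I" "w \<in> ?J \<union> ?I" for v w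
    proof -
      have "\<bar>v\<bar> \<le> int s" "\<bar>w\<bar> \<le> int (s + 1)" using that \<sigma> by auto
      then have "affine_size (shift L0 v) \<le> 3 * s + 2" "affine_size (shift L w) \<le> 3 * s + 2"
        using affine_size_shift[of v s L0] affine_size_shift[of w "s+1" L] size by auto
      from derives_form_diff[OF ax(1) this(2,1) N8(2)] show ?thesis
        by (simp add: lin_shift_diff lin)
    qed
    \<comment> \<open>The error term is \<open>x * (\<sigma> * x - \<sigma>)\<close>, which is
      \<open>\<sigma>\<close> times the Boolean axiom \<open>x^2 - x\<close>.\<close>
    have one: "derives N \<Gamma> 10 (?x * (yvar (shift L (v + \<sigma>)) - yvar (shift L0 v)))" (is "derives _ _ _ ?T")
      if v: "v \<in> ?I" for v
    proof -
      define E where "E = yvar (shift L (v + \<sigma>)) - yvar (shift L0 v)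
        - (Const (of_int \<sigma>) * ?x - Const (of_int \<sigma>))"
      have "derives N \<Gamma> 3 E" using diff[of v "v + \<sigma>"] v by (simp add: E_def)
      then have "derives N \<Gamma> (3 + 1) (?x * E)" by (rule derives_Var)
      moreover have "?T = Const 1 * (?x * E) + Const (of_int \<sigma>) * (?x * ?x - ?x)"
        by (simp add: E_def algebra_simps)
      moreover have "norm_le N ?T"
        by (rule norm_le_mono[OF norm_le_mult[OF nx nb]]) (use N8 in simp)
      ultimately have "derives N \<Gamma> ((3 + 1) + 1 + 1) ?T"
        using derives_combination[OF _ bool] by blast
      then show ?thesis by (rule derives_le) simp
    qed
    \<comment> \<open>Here the error term is \<open>(1 - x) * \<sigma> * x\<close>, which is
      \<open>- \<sigma>\<close> times the Boolean axiom.\<close>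
    have zero: "derives N \<Gamma> 10 ((1 - ?x) * (yvar (shift L v) - yvar (shift L0 v)))" (is "derives _ _ _ ?T")
      if v: "v \<in> ?I" for v
    proof -
      define E where "E = yvar (shift L v) - yvar (shift L0 v) - Const (of_int \<sigma>) * ?x"
      have E: "derives N \<Gamma> 3 E" using diff[of v v] v by (simp add: E_def)
      then have xE: "derives N \<Gamma> (3 + 1) (?x * E)" by (rule derives_Var)
      have nE: "norm_le 3 E"
        unfolding E_def by (intro norm_le_diff[OF nb n\<sigma>]) auto
      have E': "derives N \<Gamma> (3 + (3 + 1) + 1) ((1 - ?x) * E)"
      proof (rule derives_combination[OF E xE, of _ 1 "-1"])
        show "(1 - ?x) * E = Const 1 * E + Const (- 1) * (?x * E)"
          by (simp add: Const_uminus algebra_simps)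
        show "norm_le N ((1 - ?x) * E)"
          using norm_le_mult[OF n1x nE] N8 by (auto elim: norm_le_mono)
      qed
      have "derives N \<Gamma> ((3 + (3 + 1) + 1) + 1 + 1) ?T"
      proof (rule derives_combination[OF E' bool, of _ 1 "- of_int \<sigma>"])
        show "?T = Const 1 * ((1 - ?x) * E) + Const (- of_int \<sigma>) * (?x * ?x - ?x)"
          by (simp add: E_def Const_uminus algebra_simps)
        show "norm_le N ?T"
          by (rule norm_le_mono[OF norm_le_mult[OF n1x nb]]) (use N8 in simp)
      qed
      then show ?thesis by (rule derives_le) simp
    qed
    let ?G = "\<Prod>v\<in>?I. yvar (shift L0 v)"
    have xG: "derives N \<Gamma> (1 + 1) (?x * ?G)"
      using derives_Var[OF st, of "X h"] by (simp add: value_prod_def)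
    have x1G: "derives N \<Gamma> (1 + (1 + 1) + 1) ((1 - ?x) * ?G)"
    proof (rule derives_combination[OF st[unfolded value_prod_def] xG, of _ 1 "-1"])
      show "(1 - ?x) * ?G = Const 1 * ?G + Const (- 1) * (?x * ?G)"
        by (simp add: Const_uminus algebra_simps)
      show "norm_le N ((1 - ?x) * ?G)"
        by (rule norm_le_mono[OF norm_le_mult[OF n1x norm_le_monomial1[OF monomial_prod, of ?I 1]]])
          (use N8 in auto)
    qed
    have "derives N \<Gamma> (1 + 1 + card ?I * (10 + card ?I + 0 + 1))
        (?x * (\<Prod>v\<in>?I. yvar (shift L (v + \<sigma>))) * 1)"
      by (rule derives_replace[OF _ _ one monomial_1])
        (use xG nx N8 in \<open>auto elim: norm_le_mono\<close>)
    from derives_monomial_mult[OF this P(1)]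
    have 1: "derives N \<Gamma> (1 + 1 + (2 * s + 1) * (10 + (2 * s + 1) + 0 + 1) + 2) (?x * value_prod L (s + 1))"
      by (simp only: P(2) mult_ac cI mult_1_left)
    have "derives N \<Gamma> (1 + (1 + 1) + 1 + card ?I * (10 + card ?I + 0 + 1))
        ((1 - ?x) * (\<Prod>v\<in>?I. yvar (shift L v)) * 1)"
      by (rule derives_replace[OF _ _ zero monomial_1])
        (use x1G n1x N8 in \<open>auto elim: norm_le_mono\<close>)
    from derives_monomial_mult[OF this Q(1)]
    have 2: "derives N \<Gamma> (1 + (1 + 1) + 1 + (2 * s + 1) * (10 + (2 * s + 1) + 0 + 1) + 2)
        ((1 - ?x) * value_prod L (s + 1))"
      by (simp only: Q(2) mult_ac cI mult_1_left)
    have "norm_le N (value_prod L (s + 1))"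
      unfolding value_prod_def
      by (rule norm_le_monomial1[OF monomial_prod]) (use N8 in auto)
    from derives_combination[OF 1 2 _ this, of 1 1] show ?thesis
      by (rule derives_le) (simp_all add: algebra_simps)
  qed
qed

text \<open>Every step moves one nonzero coefficient, possibly the constant term, by one towards
  zero and so lowers the unary size by exactly one.\<close>

lemma derives_value_prod:
  assumes "form_axioms n \<subseteq> \<Gamma>" "bool_polys n \<subseteq> \<Gamma>"
    and "Poly_Mapping.keys L \<subseteq> {0..n}" "affine_size L = s" "6 * s + 8 \<le> N"
  shows "derives N \<Gamma> (1 + s * (2 * (2 * s + 1) * (2 * s + 12) + 13)) (value_prod L s)"
  using assms(3-)
proof (induction s arbitrary: L)
  case 0
  then have "L = 0" by (simp add: affine_size_eq_0)
  \<comment> \<open>The only factor is the variable of the zero form, which coincides with its own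
    defining axiom.\<close>
  then have "value_prod L 0 = yvar 0 - lin n 0"
    by (simp add: value_prod_def shift_def lin_def affine_poly_def)
  then show ?case
    using derives_form_axiom[OF assms(1), of 0 N] 0 by (simp add: affine_size_def)
next
  case (Suc s)
  have "Poly_Mapping.keys L \<noteq> {}" using Suc.prems by (auto simp: affine_size_def)
  then obtain h where h: "h \<in> Poly_Mapping.keys L" by blast
  define \<sigma> where "\<sigma> = sgn (Poly_Mapping.lookup L h)"
  define L0 where "L0 = L - Poly_Mapping.single h \<sigma>"
  have \<sigma>: "\<bar>\<sigma>\<bar> = 1" using h by (simp add: \<sigma>_def in_keys_iff abs_sgn_eq)
  have keys: "Poly_Mapping.keys L0 \<subseteq> Poly_Mapping.keys L"
    using h by (auto simp: L0_def in_keys_iff lookup_minus lookup_single when_def split: if_splits)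
  have "affine_size L0 = (\<Sum>i\<in>Poly_Mapping.keys L. nat \<bar>Poly_Mapping.lookup L0 i\<bar>)"
    by (intro affine_size_superset keys) auto
  also have "\<dots> = nat \<bar>Poly_Mapping.lookup L0 h\<bar>
      + (\<Sum>i\<in>Poly_Mapping.keys L - {h}. nat \<bar>Poly_Mapping.lookup L0 i\<bar>)"
    using h by (intro sum.remove) auto
  also have "(\<Sum>i\<in>Poly_Mapping.keys L - {h}. nat \<bar>Poly_Mapping.lookup L0 i\<bar>)
      = (\<Sum>i\<in>Poly_Mapping.keys L - {h}. nat \<bar>Poly_Mapping.lookup L i\<bar>)"
    by (intro sum.cong) (auto simp: L0_def lookup_minus lookup_single)
  also have "nat \<bar>Poly_Mapping.lookup L h\<bar> = nat \<bar>Poly_Mapping.lookup L0 h\<bar> + 1"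
    using h by (auto simp: L0_def lookup_minus \<sigma>_def in_keys_iff sgn_if)
  then have "nat \<bar>Poly_Mapping.lookup L0 h\<bar> = nat \<bar>Poly_Mapping.lookup L h\<bar> - 1" by simp
  also have "nat \<bar>Poly_Mapping.lookup L h\<bar> - 1
      + (\<Sum>i\<in>Poly_Mapping.keys L - {h}. nat \<bar>Poly_Mapping.lookup L i\<bar>) = affine_size L - 1"
    using h sum.remove[OF finite_keys h, of "\<lambda>i. nat \<bar>Poly_Mapping.lookup L i\<bar>"]
    by (simp add: affine_size_def in_keys_iff)
  finally have size: "affine_size L0 = s" using Suc.prems by simp
  have L: "L = L0 + Poly_Mapping.single h \<sigma>" by (simp add: L0_def)
  have IH: "derives N \<Gamma> (1 + s * (2 * (2 * s + 1) * (2 * s + 12) + 13)) (value_prod L0 s)"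
    by (rule Suc.IH) (use keys Suc.prems size in auto)
  have "derives N (insert (value_prod L0 s) \<Gamma>) (2 * (2 * s + 1) * (2 * s + 12) + 13)
      (value_prod (L0 + Poly_Mapping.single h \<sigma>) (s + 1))"
    by (rule derives_value_prod_step[of n])
      (use assms(1,2) h \<sigma> size Suc.prems L in auto)
  from derives_cut[OF IH this]
  have "derives N \<Gamma> (1 + Suc s * (2 * (2 * s + 1) * (2 * s + 12) + 13)) (value_prod L (Suc s))"
    by (simp add: L add_ac)
  then show ?case
    by (rule derives_le) (intro add_mono mult_mono; simp)
qed

text \<open>The value product times \<open>A\<close> contains \<open>yvar L\<close> as its factor
  for the value 0. The remaining factors belong to nonzero values and are cancelled one by
  one.\<close>

lemma derives_contraction:
  assumes ax: "form_axioms n \<subseteq> \<Gamma>" "bool_polys n \<subseteq> \<Gamma>"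
    and keys: "Poly_Mapping.keys L \<subseteq> {0..n}" and size: "affine_size L \<le> s" and N: "6 * s + 8 \<le> N"
    and A: "monomial d A" and hyp: "yvar L * (yvar L * A) \<in> \<Gamma>"
  shows "derives N \<Gamma> (1 + s * (2 * (2 * s + 1) * (2 * s + 12) + 13) + d + 2 * s * (4 * s + 2 * d + 10)) (yvar L * A)"
proof -
  define s' where "s' = affine_size L"
  have s': "s' \<le> s" using size by (simp add: s'_def)
  let ?c = "4 * s + 2 * d + 10"
  have N1: "1 \<le> N" using N by simp
  have mLA: "monomial (d + 1) (yvar L * A)" using monomial_mult[OF monomial_Var A] by simp
  have sq: "derives N \<Gamma> 1 (yvar L * (yvar L * A))"
    by (rule derives_axiom[OF hyp norm_le_monomial1[OF monomial_mult[OF monomial_Var mLA] N1]])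
  have elim: "derives N \<Gamma> (k + card W * ?c) (yvar L * A)"
    if "finite W" "card W \<le> 2 * s" "\<And>v. v \<in> W \<Longrightarrow> v \<noteq> 0 \<and> \<bar>v\<bar> \<le> int s"
      and "derives N \<Gamma> k (yvar L * A * (\<Prod>v\<in>W. yvar (shift L v)))" for W k
    using that
  proof (induction W arbitrary: k rule: finite_induct)
    case empty
    then show ?case by simp
  next
    case (insert w W)
    let ?W = "\<Prod>v\<in>W. yvar (shift L v)"
    have w: "w \<noteq> 0" "\<bar>w\<bar> \<le> int s" using insert.prems(2)[of w] by auto
    have cW: "card W + 1 \<le> 2 * s" using insert by simp
    have mW: "monomial (card W) ?W" by (rule monomial_prod[OF insert.hyps(1)])
    have mB: "monomial (d + 1 + card W) (yvar L * A * ?W)" by (rule monomial_mult[OF mLA mW])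
    define E where "E = yvar (shift L w) - yvar L + Const (of_int w)"
    have "derives N \<Gamma> 3 (yvar (shift L w) - yvar L - lin n (shift L w - L))"
      by (rule derives_form_diff[OF ax(1), of _ "2 * s"])
        (use N size affine_size_shift[OF w(2), of L] in auto)
    moreover have "lin n (shift L w - L) = - Const (of_int w)"
      using lin_const[of n "- w"] by (simp add: shift_def single_uminus Const_uminus)
    ultimately have E: "derives N \<Gamma> 3 E" by (simp add: E_def)
    have nE: "norm_le (s + 2) E"
      unfolding E_def using w(2)
      by (intro norm_le_add[OF norm_le_diff[OF norm_le_Var[of 1] norm_le_Var[of 1] order_refl] norm_le_Const[OF order_refl]]) auto
    have 1: "derives N \<Gamma> (3 + (d + 1 + card W)) (yvar L * A * ?W * E)"
      by (rule derives_monomial_mult[OF E mB])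
    have 2: "derives N \<Gamma> (1 + card W) (?W * (yvar L * (yvar L * A)))"
      by (rule derives_monomial_mult[OF sq mW])
    \<comment> \<open>Multiplying \<open>E\<close> out gives a term with the square of
      \<open>yvar L\<close>; adding the multiple of the hypothesis removes it. What is left is
      \<open>yvar L * A * ?W\<close> times \<open>yvar (shift L w) + w\<close>.\<close>
    define T where "T = yvar L * A * ?W * E + ?W * (yvar L * (yvar L * A))"
    have T: "derives N \<Gamma> ((3 + (d + 1 + card W)) + (1 + card W) + 1) T"
    proof (rule derives_combination[OF 1 2, of _ 1 1])
      have "norm_le (s + 2 + 1) T"
        unfolding T_def
        by (intro norm_le_add[OF norm_le_monomial_mult[OF mB nE]
              norm_le_monomial1[OF monomial_mult[OF mW monomial_mult[OF monomial_Var mLA]]] order_refl]) simp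
      then show "norm_le N T" by (rule norm_le_mono) (use N in simp)
    qed (simp add: T_def)
    have w': "Const (of_int w) * (yvar L * A * ?W)
        = Const 1 * T + Const (-1) * (yvar L * A * (\<Prod>v\<in>insert w W. yvar (shift L v)))"
      using insert.hyps by (simp add: T_def E_def Const_uminus algebra_simps)
    have "norm_le N (Const (of_int w) * (yvar L * A * ?W))"
      using w(2) N by (intro norm_le_scale[OF norm_le_monomial1[OF mB order_refl]]) auto
    from derives_combination[OF T insert.prems(3) w' this]
    have 3: "derives N \<Gamma> ((3 + (d + 1 + card W)) + (1 + card W) + 1 + k + 1) (Const (of_int w) * (yvar L * A * ?W))" .
    \<comment> \<open>Subtracting the product that contains the factor for \<open>w\<close> has left
      \<open>w\<close> times the shorter product; as \<open>w\<close> is nonzero, it is divided out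
      and a monomial remains.\<close>
    have "yvar L * A * ?W = Const (1 / of_int w) * (Const (of_int w) * (yvar L * A * ?W))"
      using w(1) by (simp add: mult.assoc[symmetric] flip: Const_mult)
    from derives_scaled[OF 3 this norm_le_monomial1[OF mB N1]]
    have "derives N \<Gamma> (k + ?c) (yvar L * A * ?W)"
      by (rule derives_le) (use cW in simp)
    then have "derives N \<Gamma> (k + ?c + card W * ?c) (yvar L * A)"
      by (intro insert.IH) (use insert.prems cW in auto)
    then show ?case using insert.hyps by (simp add: add_ac)
  qed
  have "derives N \<Gamma> (1 + s' * (2 * (2 * s' + 1) * (2 * s' + 12) + 13)) (value_prod L s')"
    by (rule derives_value_prod[OF ax keys s'_def[symmetric]]) (use N s' in simp)
  then have "derives N \<Gamma> (1 + s * (2 * (2 * s + 1) * (2 * s + 12) + 13)) (value_prod L s')"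
    by (rule derives_le) (use s' in \<open>intro add_mono mult_mono; simp\<close>)
  from derives_monomial_mult[OF this A]
  have "derives N \<Gamma> (1 + s * (2 * (2 * s + 1) * (2 * s + 12) + 13) + d) (A * value_prod L s')" .
  moreover have "A * value_prod L s' = yvar L * A * (\<Prod>v\<in>{- int s'..int s'} - {0}. yvar (shift L v))"
    by (simp add: value_prod_def prod.remove[of _ 0] shift_def mult_ac)
  moreover have card: "card ({- int s'..int s'} - {0}) = 2 * s'"
    by (simp add: nat_add_distrib nat_mult_distrib)
  ultimately have "derives N \<Gamma> (1 + s * (2 * (2 * s + 1) * (2 * s + 12) + 13) + d
      + card ({- int s'..int s'} - {0}) * ?c) (yvar L * A)"
    by (intro elim) (use s' in auto)
  then have "derives N \<Gamma> (1 + s * (2 * (2 * s + 1) * (2 * s + 12) + 13) + d + 2 * s' * ?c) (yvar L * A)"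
    by (simp only: card)
  then show ?thesis
    by (rule derives_le) (use s' in \<open>intro add_mono mult_mono; simp\<close>)
qed

text \<open>The size of a proof does not bound \<open>\<alpha>\<close> and \<open>\<beta>\<close>, because cancellation may keep the resolvent
  small. Cramer's rule gives bounded coefficients, at the price of a factor \<open>d\<close>.\<close>

lemma bounded_linear_relation:
  assumes M: "\<And>i. M i = \<alpha> * L1 i + \<beta> * (L2 i :: int)"
    and s: "\<And>i. \<bar>M i\<bar> \<le> s" "\<And>i. \<bar>L1 i\<bar> \<le> s" "\<And>i. \<bar>L2 i\<bar> \<le> s" "1 \<le> s"
  obtains d a b where "d \<noteq> 0" "\<bar>d\<bar> \<le> 2 * s * s" "\<bar>a\<bar> \<le> 2 * s * s" "\<bar>b\<bar> \<le> 2 * s * s"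
    "\<And>i. d * M i = a * L1 i + b * L2 i"
proof -
  have det: "\<bar>p * q - r * t\<bar> \<le> 2 * s * s"
    if "\<bar>p\<bar> \<le> s" "\<bar>q\<bar> \<le> s" "\<bar>r\<bar> \<le> s" "\<bar>t\<bar> \<le> s" for p q r t
  proof -
    have "\<bar>p * q\<bar> \<le> s * s" "\<bar>r * t\<bar> \<le> s * s"
      unfolding abs_mult using that s(4) by (auto intro!: mult_mono)
    then show ?thesis by linarith
  qed
  have le: "\<bar>c\<bar> \<le> 2 * s * s" if "\<bar>c\<bar> \<le> s" for c
    using det[of c 1 0 0] that s(4) by simp
  \<comment> \<open>Cases by rank. With a nonzero 2 by 2 minor Cramer's rule applies; otherwise all
    three vectors are multiples of one of \<open>L1\<close> and \<open>L2\<close>, and single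
    entries serve as coefficients, or everything vanishes.\<close>
  consider i j where "L1 i * L2 j - L1 j * L2 i \<noteq> 0"
    | i where "\<And>i j. L1 i * L2 j = L1 j * L2 i" "L1 i \<noteq> 0"
    | i where "\<And>i. L1 i = 0" "L2 i \<noteq> 0"
    | "\<And>i. L1 i = 0" "\<And>i. L2 i = 0"
    by force
  then show ?thesis
  proof cases
    case (1 i j)
    show ?thesis
      by (rule that[of "L1 i * L2 j - L1 j * L2 i" "M i * L2 j - M j * L2 i" "L1 i * M j - L1 j * M i"])
        (use 1 in \<open>auto intro: det[OF s(1) s(3) s(1) s(3)] det[OF s(2) s(1) s(2) s(1)]
          det[OF s(2) s(3) s(2) s(3)], simp add: M algebra_simps\<close>)
  next
    case (2 i)
    have "L1 i * M j = M i * L1 j + 0 * L2 j" for j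
      using 2(1)[of i j] by (simp add: M algebra_simps)
    then show ?thesis
      by (intro that[of "L1 i" "M i" 0]) (use 2(2) s in \<open>auto intro!: le\<close>)
  next
    case (3 i)
    show ?thesis
      by (rule that[of "L2 i" 0 "M i"]) (use 3 s in \<open>auto intro!: le simp: M\<close>)
  next
    case 4
    show ?thesis
      by (rule that[of 1 0 0]) (use 4 le[of 1] s(4) in \<open>auto simp: M\<close>)
  qed
qed

lemma lookup_lin_comb:
  "Poly_Mapping.lookup (lin_comb \<alpha> L1 \<beta> L2) i = \<alpha> * Poly_Mapping.lookup L1 i + \<beta> * Poly_Mapping.lookup L2 i"
  by (simp add: lin_comb_def lookup_add map.rep_eq when_def)

text \<open>The bounded relation between the three variables is multiplied by \<open>A * B\<close>,
  multiples of the two premises remove the terms in \<open>yvar L1\<close> and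
  \<open>yvar L2\<close>, and the factor \<open>c\<close> is divided out. The bound on
  \<open>N\<close> comes from coefficients up to \<open>2 * s * s\<close>.\<close>

lemma derives_resolution:
  fixes \<alpha> \<beta> L1 L2 defines "M \<equiv> lin_comb \<alpha> L1 \<beta> L2"
  assumes ax: "form_axioms n \<subseteq> \<Gamma>"
    and size: "affine_size M \<le> s" "affine_size L1 \<le> s" "affine_size L2 \<le> s" "1 \<le> s"
    and N: "6 * s * s * (s + 1) + 4 * s * s \<le> N"
    and A: "monomial d A" and B: "monomial e B"
    and hyp: "yvar L1 * A \<in> \<Gamma>" "yvar L2 * B \<in> \<Gamma>"
  shows "derives N \<Gamma> (10 + 2 * d + 2 * e) (yvar M * (A * B))"
proof -
  have "\<bar>Poly_Mapping.lookup L i\<bar> \<le> int s" if "affine_size L \<le> s" for L i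
    using affine_size_lookup[of L i] that by linarith
  then have bd: "\<bar>Poly_Mapping.lookup M i\<bar> \<le> int s" "\<bar>Poly_Mapping.lookup L1 i\<bar> \<le> int s"
    "\<bar>Poly_Mapping.lookup L2 i\<bar> \<le> int s" for i
    using size by auto
  obtain c a b where c: "c \<noteq> 0" and t: "\<bar>c\<bar> \<le> 2 * int s * int s" "\<bar>a\<bar> \<le> 2 * int s * int s" "\<bar>b\<bar> \<le> 2 * int s * int s"
    and rel: "\<And>i. c * Poly_Mapping.lookup M i = a * Poly_Mapping.lookup L1 i + b * Poly_Mapping.lookup L2 i"
    by (rule bounded_linear_relation[of "Poly_Mapping.lookup M" \<alpha> "Poly_Mapping.lookup L1" \<beta>
          "Poly_Mapping.lookup L2" "int s"])
      (use bd size(4) in \<open>auto simp: M_def lookup_lin_comb\<close>)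
  have s2: "1 \<le> 2 * s * s" using size(4) by (cases s) auto
  define E where "E = Const (of_int c) * yvar M - Const (of_int a) * yvar L1 - Const (of_int b) * yvar L2"
  have E: "derives N \<Gamma> 5 E"
    unfolding E_def
    by (rule derives_linear_relation[OF rel ax size(1-3), of "2 * s * s"]) (use t N s2 in auto)
  have N1: "1 \<le> N" using N s2 by linarith
  have mAB: "monomial (d + e) (A * B)" by (rule monomial_mult[OF A B])
  have n: "norm_le (2 * s * s) (Const (of_int r) * (yvar L * (A * B)))" if "\<bar>r\<bar> \<le> 2 * int s * int s" for r L
    using that
    by (intro norm_le_scale[OF norm_le_monomial1[OF monomial_mult[OF monomial_Var mAB] order_refl]])
      (simp add: nat_le_iff)
  have 1: "derives N \<Gamma> (5 + (d + e)) (A * B * E)"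
    by (rule derives_monomial_mult[OF E mAB])
  have 2: "derives N \<Gamma> (1 + e) (B * (yvar L1 * A))"
    by (intro derives_monomial_mult[OF _ B] derives_axiom hyp norm_le_monomial1[OF monomial_mult[OF monomial_Var A] N1])
  have 3: "derives N \<Gamma> (1 + d) (A * (yvar L2 * B))"
    by (intro derives_monomial_mult[OF _ A] derives_axiom hyp norm_le_monomial1[OF monomial_mult[OF monomial_Var B] N1])
  define T where "T = Const (of_int c) * (yvar M * (A * B)) - Const (of_int b) * (yvar L2 * (A * B))"
  have T: "derives N \<Gamma> ((5 + (d + e)) + (1 + e) + 1) T"
  proof (rule derives_combination[OF 1 2, of _ 1 "of_int a"])
    show "T = Const 1 * (A * B * E) + Const (of_int a) * (B * (yvar L1 * A))"
      by (simp add: T_def E_def algebra_simps)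
    show "norm_le N T"
      unfolding T_def by (rule norm_le_diff[OF n n]) (use t N in auto)
  qed
  define U where "U = Const (of_int c) * (yvar M * (A * B))"
  have U: "derives N \<Gamma> ((5 + (d + e)) + (1 + e) + 1 + (1 + d) + 1) U"
  proof (rule derives_combination[OF T 3, of _ 1 "of_int b"])
    show "U = Const 1 * T + Const (of_int b) * (A * (yvar L2 * B))"
      by (simp add: T_def U_def algebra_simps)
    show "norm_le N U"
      unfolding U_def by (rule norm_le_mono[OF n]) (use t N in auto)
  qed
  have "yvar M * (A * B) = Const (1 / of_int c) * U"
    using c by (simp add: U_def mult.assoc[symmetric] flip: Const_mult)
  from derives_scaled[OF U this norm_le_monomial1[OF monomial_mult[OF monomial_Var mAB] N1]]
  show ?thesis by (rule derives_le) simp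
qed

section \<open>Simplification and the Boolean axioms\<close>

lemma derives_simplification:
  assumes ax: "form_axioms n \<subseteq> \<Gamma>" and k: "k \<noteq> 0" "\<bar>k\<bar> < int N"
    and A: "monomial d A" and hyp: "yvar (Poly_Mapping.single 0 k) * A \<in> \<Gamma>"
  shows "derives N \<Gamma> (4 + d) A"
proof -
  let ?yvar = "yvar (Poly_Mapping.single 0 k)"
  have N1: "1 \<le> N" using k by simp
  have "derives N \<Gamma> 1 (?yvar - Const (of_int k))"
    using derives_form_axiom[OF ax, of "Poly_Mapping.single 0 k" N] k(2)
    by (simp add: affine_size_single lin_const)
  from derives_monomial_mult[OF this A]
  have 1: "derives N \<Gamma> (1 + d) (A * (?yvar - Const (of_int k)))" .
  have 2: "derives N \<Gamma> 1 (?yvar * A)"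
    by (intro derives_axiom hyp norm_le_monomial1[OF monomial_mult[OF monomial_Var A] N1])
  have 3: "derives N \<Gamma> (1 + d + 1 + 1) (Const (of_int k) * A)"
  proof (rule derives_combination[OF 1 2, of _ "-1" 1])
    show "norm_le N (Const (of_int k) * A)"
      using k(2) by (intro norm_le_scale[OF norm_le_monomial1[OF A order_refl]]) auto
  qed (simp add: Const_uminus algebra_simps)
  have "A = Const (1 / of_int k) * (Const (of_int k) * A)"
    using k(1) by (simp add: mult.assoc[symmetric] flip: Const_mult)
  from derives_scaled[OF 3 this norm_le_monomial1[OF A N1]]
  show ?thesis by (rule derives_le) simp
qed

text \<open>Replacing first \<open>y\<close> of \<open>x\<close> by \<open>x\<close> and then
  \<open>y\<close> of \<open>x - 1\<close> by \<open>x - 1\<close> turns the product into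
  \<open>x^2 - x\<close>.\<close>

lemma derives_bool_axiom:
  assumes ax: "form_axioms n \<subseteq> \<Gamma>" "bool_polys n \<subseteq> \<Gamma>" and h: "h \<in> {1..n}" and N: "3 \<le> N"
  shows "derives N \<Gamma> 9 (yvar (Poly_Mapping.single h 1) * yvar (Poly_Mapping.single h 1 - Poly_Mapping.single 0 1))"
proof -
  let ?x = "Var (X h)" and ?L0 = "Poly_Mapping.single h (1::int)"
  let ?L1 = "?L0 - Poly_Mapping.single 0 1"
  have l: "lin n ?L0 = ?x" "lin n ?L1 = ?x - 1"
    using lin_single[OF h, of 1] lin_const[of n 1] by (simp_all add: lin_diff)
  have s: "affine_size ?L0 < N" "affine_size ?L1 < N"
    using affine_size_diff[of ?L0 "Poly_Mapping.single 0 1"] N by (simp_all only: affine_size_single)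
  have d0: "derives N \<Gamma> (1 + 1) (yvar ?L1 * (yvar ?L0 - ?x))"
    using derives_Var[OF derives_form_axiom[OF ax(1) s(1)], of "Y ?L1"] by (simp only: l)
  have d1: "derives N \<Gamma> (1 + 1) (?x * (yvar ?L1 - (?x - 1)))"
    using derives_Var[OF derives_form_axiom[OF ax(1) s(2)], of "X h"] by (simp only: l)
  have n2: "norm_le 1 (Var u * Var v)" for u v
    using norm_le_mono1[of 1 "[u, v]"] by simp
  define T where "T = yvar ?L0 * yvar ?L1 - ?x * ?x + ?x"
  have T: "derives N \<Gamma> ((1 + 1) + (1 + 1) + 1) T"
  proof (rule derives_combination[OF d0 d1, of _ 1 1])
    show "norm_le N T"
      unfolding T_def using N
      by (intro norm_le_add[OF norm_le_diff[OF n2 n2 order_refl] norm_le_Var[of 1]]) auto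
  qed (simp add: T_def algebra_simps)
  have b: "derives N \<Gamma> 1 (?x * ?x - ?x)"
    by (rule derives_boolean[OF ax(2) h]) (use N in simp)
  have "norm_le N (yvar ?L0 * yvar ?L1)" by (rule norm_le_mono[OF n2]) (use N in simp)
  from derives_combination[OF T b _ this, of 1 1]
  show ?thesis by (rule derives_le) (simp_all add: T_def)
qed

section \<open>Simulation of proofs\<close>

abbreviation disj_prod :: "disjunction \<Rightarrow> qpoly" where
  "disj_prod D \<equiv> (\<Prod>L\<in>#D. yvar L)"

lemma hat_eq: "hat n D = insert (disj_prod D) ((\<lambda>L. yvar L - lin n L) ` set_mset D)"
  by (simp add: hat_def lin_def)

lemma pc_size_append: "pc_size (\<rho> @ \<sigma>) = pc_size \<rho> + pc_size \<sigma>"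
  by (simp add: pc_size_def)

lemma derives_obtain:
  assumes "derives N \<Gamma> k R"
  obtains \<rho> where "pc_derivation \<Gamma> \<rho>" "R \<in> set \<rho>" "pc_size \<rho> \<le> k * N"
proof -
  obtain \<rho> where \<rho>: "pc_derivation \<Gamma> \<rho>" "R \<in> set \<rho>" "length \<rho> \<le> k" "\<forall>S\<in>set \<rho>. norm_le N S"
    using assms by (auto simp: derives_def)
  have "pc_size \<rho> \<le> length \<rho> * N"
    using \<rho>(4) unfolding pc_size_def by (induction \<rho>) (auto dest!: qpoly_size_le)
  also have "\<dots> \<le> k * N" using \<rho>(3) by simp
  finally show ?thesis using that \<rho> by blast
qed

lemma disj_size_add_mset: "disj_size (add_mset L A) = affine_size L + disj_size A"
  by (simp add: disj_size_def)

lemma disj_size_union: "disj_size (A + B) = disj_size A + disj_size B"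
  by (simp add: disj_size_def)

text \<open>A nonzero form has unary size at least 1. Thus the degree of the monomial of a
  disjunction, and with it the number of multiplications by variables, is controlled by the
  size.\<close>

lemma size_le_disj_size: "0 \<notin># D \<Longrightarrow> size D \<le> disj_size D"
proof (induction D)
  case (add L D)
  then have "affine_size L \<noteq> 0" by (auto simp: affine_size_eq_0)
  with add show ?case by (simp add: disj_size_add_mset)
qed simp

text \<open>The coefficients \<open>\<plusminus>1\<close> have bit size \<open>0\<close>, and the defining axiom of the variable of the zero form
  is that variable itself; hence disjunctions containing the zero form cost nothing. This matters
  because the size of a Res-Lin proof does not count such disjuncts at all.\<close>

lemma zero_form_disj_prod:
  assumes "form_axioms n \<subseteq> \<Gamma>" "0 \<in># D"
  obtains \<rho> where "pc_derivation \<Gamma> \<rho>" "disj_prod D \<in> set \<rho>" "pc_size \<rho> = 0"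
proof -
  have "yvar 0 = yvar 0 - lin n 0" by (simp add: lin_def affine_poly_def)
  then have y0: "yvar 0 \<in> \<Gamma>" using assms(1) unfolding form_axioms_def by blast
  have "\<exists>\<rho>. pc_derivation \<Gamma> \<rho> \<and> yvar 0 * disj_prod A \<in> set \<rho> \<and> pc_size \<rho> = 0" for A
  proof (induction A)
    case empty
    have "qpoly_size (yvar 0) = 0" by (rule qpoly_size_monomial[OF monomial_Var])
    with y0 show ?case by (intro exI[of _ "[yvar 0]"]) (simp add: pc_derivation_def pc_size_def)
  next
    case (add L A)
    then obtain \<rho> where \<rho>: "pc_derivation \<Gamma> \<rho>" "yvar 0 * disj_prod A \<in> set \<rho>" "pc_size \<rho> = 0" by blast
    let ?R = "yvar L * (yvar 0 * disj_prod A)"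
    have "qpoly_size ?R = 0"
      by (rule qpoly_size_monomial[OF monomial_mult[OF monomial_Var monomial_mult[OF monomial_Var monomial_prod_mset]]])
    then show ?case
      using \<rho>(3) pc_derivation_snoc[OF \<rho>(1) disjI2[OF pc_step.multiplication[OF \<rho>(2)]], of "Y L"]
      by (intro exI[of _ "\<rho> @ [?R]"]) (simp add: pc_size_def mult_ac)
  qed
  from this[of "D - {#0#}"] assms(2) that show ?thesis
    by (metis image_mset_add_mset insert_DiffM prod_mset.add_mset)
qed

lemma keys_lin_comb:
  "Poly_Mapping.keys (lin_comb \<alpha> L1 \<beta> L2) \<subseteq> Poly_Mapping.keys L1 \<union> Poly_Mapping.keys L2"
  by (auto simp: in_keys_iff lookup_lin_comb)

lemma reslin_step_disj_over:
  assumes "reslin_step n P D" "\<forall>E\<in>P. disj_over n E"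
  shows "disj_over n D"
  using assms
proof (induction rule: reslin_step.induct)
  case (resolution L1 A L2 B \<alpha> \<beta>)
  have "disj_over n (add_mset L1 A)" "disj_over n (add_mset L2 B)"
    using resolution by blast+
  then show ?case using keys_lin_comb[of \<alpha> L1 \<beta> L2] unfolding disj_over_def by auto
next
  case (weakening A L)
  then show ?case unfolding disj_over_def by auto
next
  case (simplification k A)
  then have "disj_over n (add_mset (Poly_Mapping.single 0 k) A)" by blast
  then show ?case unfolding disj_over_def by auto
next
  case (contraction L A)
  then have "disj_over n (add_mset L (add_mset L A))" by blast
  then show ?case unfolding disj_over_def by auto
qed

lemma reslin_proof_disj_over:
  assumes "reslin_proof n K \<pi> D" "\<forall>Q\<in>K. disj_over n Q" "i < length \<pi>"
  shows "disj_over n (\<pi> ! i)"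
  using assms(3)
proof (induction i rule: less_induct)
  case (less i)
  consider "\<pi> ! i \<in> K" | h where "h \<in> {1..n}" "\<pi> ! i = bool_axiom h"
    | "reslin_step n (set (take i \<pi>)) (\<pi> ! i)"
    using assms(1) less.prems unfolding reslin_proof_def by blast
  then show ?case
  proof cases
    case 1
    then show ?thesis using assms(2) by blast
  next
    case (2 h)
    then show ?thesis
      by (auto simp: disj_over_def bool_axiom_def in_keys_iff lookup_minus lookup_single lookup_one when_def split: if_splits)
  next
    case 3
    then show ?thesis
      by (rule reslin_step_disj_over) (use less in \<open>auto simp: in_set_conv_nth\<close>)
  qed
qed

section \<open>Cost of a single line\<close>

lemma monomial_disj_prod: "monomial (size D) (disj_prod D)"
  by (rule monomial_prod_mset)

lemma mult_le_cube: "1 \<le> s \<Longrightarrow> s \<le> s ^ 3 \<and> s * s \<le> s ^ 3" for s :: nat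
  by (simp add: power3_eq_cube)

text \<open>Only the conclusion has to avoid the zero form, because the contexts multiplied onto
  relations consist of disjuncts of \<open>D\<close>. The norm bound is dictated by resolution, the
  cubic length by contraction.\<close>

lemma derives_reslin_step:
  assumes step: "reslin_step n P D" and ax: "form_axioms n \<subseteq> \<Gamma>" "bool_polys n \<subseteq> \<Gamma>"
    and P: "disj_prod ` P \<subseteq> \<Gamma>" "\<And>E. E \<in> P \<Longrightarrow> disj_over n E" "\<And>E. E \<in> P \<Longrightarrow> disj_size E < s"
    and D: "0 \<notin># D" "disj_size D < s"
  shows "derives (16 * s ^ 3) \<Gamma> (200 * s ^ 3) (disj_prod D)"
  using step
proof cases
  case (resolution L1 A L2 B \<alpha> \<beta>)
  have s1: "1 \<le> s" using D by simp
  let ?M = "lin_comb \<alpha> L1 \<beta> L2"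
  have le: "affine_size ?M \<le> s" "affine_size L1 \<le> s" "affine_size L2 \<le> s"
    using D(2) P(3)[OF resolution(2)] P(3)[OF resolution(3)] unfolding resolution
    by (simp_all add: disj_size_add_mset)
  have sz: "size A + size B \<le> s"
    using D size_le_disj_size[of A] size_le_disj_size[of B] unfolding resolution
    by (simp add: disj_size_add_mset disj_size_union)
  have N: "6 * s * s * (s + 1) + 4 * s * s \<le> 16 * s ^ 3"
    using mult_le_cube[OF s1] by (simp add: algebra_simps power3_eq_cube)
  have "yvar L1 * disj_prod A \<in> \<Gamma>" "yvar L2 * disj_prod B \<in> \<Gamma>"
    using P(1) imageI[OF resolution(2), of disj_prod] imageI[OF resolution(3), of disj_prod] by auto
  from derives_resolution[OF ax(1) le s1 N monomial_disj_prod monomial_disj_prod this]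
  have "derives (16 * s ^ 3) \<Gamma> (10 + 2 * size A + 2 * size B) (disj_prod D)"
    by (simp add: resolution(1))
  then show ?thesis
    by (rule derives_le) (use sz mult_le_cube[OF s1] s1 in linarith)
next
  case (weakening A L)
  have s1: "1 \<le> s" using D by simp
  have N1: "1 \<le> 16 * s ^ 3" using s1 mult_le_cube[OF s1] by linarith
  have "disj_prod A \<in> \<Gamma>" using P(1) weakening(2) by auto
  from derives_Var[OF derives_axiom[OF this norm_le_monomial1[OF monomial_disj_prod N1]], of "Y L"]
  have "derives (16 * s ^ 3) \<Gamma> (1 + 1) (disj_prod D)" by (simp add: weakening(1))
  then show ?thesis
    by (rule derives_le) (use mult_le_cube[OF s1] s1 in linarith)
next
  case (simplification k)
  have s1: "1 \<le> s" using D by simp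
  have "affine_size (Poly_Mapping.single (0::nat) k) < s"
    using P(3)[OF simplification(1)] by (simp add: disj_size_add_mset)
  then have "nat \<bar>k\<bar> < 16 * s ^ 3"
    using mult_le_cube[OF s1] unfolding affine_size_single by linarith
  then have k: "\<bar>k\<bar> < int (16 * s ^ 3)" by (simp only: nat_less_iff[OF abs_ge_zero])
  have sz: "size D \<le> s" using D size_le_disj_size[of D] by simp
  have "yvar (Poly_Mapping.single 0 k) * disj_prod D \<in> \<Gamma>"
    using P(1) imageI[OF simplification(1), of disj_prod] by auto
  from derives_simplification[OF ax(1) simplification(2) k monomial_disj_prod this]
  show ?thesis
    by (rule derives_le) (use sz mult_le_cube[OF s1] s1 in linarith)
next
  case (contraction L A)
  have s1: "1 \<le> s" using D by simp
  have sz: "size A \<le> s" "affine_size L \<le> s"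
    using D size_le_disj_size[of A] unfolding contraction by (auto simp: disj_size_add_mset)
  have keys: "Poly_Mapping.keys L \<subseteq> {0..n}"
    using P(2)[OF contraction(2)] by (simp add: disj_over_def)
  have N: "6 * s + 8 \<le> 16 * s ^ 3" using mult_le_cube[OF s1] s1 by linarith
  have "yvar L * (yvar L * disj_prod A) \<in> \<Gamma>"
    using P(1) imageI[OF contraction(2), of disj_prod] by auto
  from derives_contraction[OF ax keys sz(2) N monomial_disj_prod this]
  have "derives (16 * s ^ 3) \<Gamma> (1 + s * (2 * (2 * s + 1) * (2 * s + 12) + 13) + size A
      + 2 * s * (4 * s + 2 * size A + 10)) (disj_prod D)"
    by (simp add: contraction(1))
  moreover have "2 * s * (4 * s + 2 * size A + 10) \<le> 2 * s * (6 * s + 10)"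
    using sz(1) by (intro mult_le_mono2) simp
  moreover have "1 + s * (2 * (2 * s + 1) * (2 * s + 12) + 13) + s + 2 * s * (6 * s + 10)
      = 8 * s ^ 3 + 64 * (s * s) + 58 * s + 1"
    by (simp add: algebra_simps power3_eq_cube)
  moreover have "\<dots> \<le> 200 * s ^ 3" using mult_le_cube[OF s1] s1 by linarith
  ultimately show ?thesis
    using sz(1) by (elim derives_le) linarith
qed

lemma derives_reslin_line:
  assumes ax: "form_axioms n \<subseteq> \<Gamma>" "bool_polys n \<subseteq> \<Gamma>" "disj_prod ` K \<subseteq> \<Gamma>"
    and line: "D \<in> K \<or> (\<exists>h\<in>{1..n}. D = bool_axiom h) \<or> reslin_step n P D"
    and P: "disj_prod ` P \<subseteq> \<Gamma>" "\<And>E. E \<in> P \<Longrightarrow> disj_over n E" "\<And>E. E \<in> P \<Longrightarrow> disj_size E < s"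
    and D: "0 \<notin># D" "disj_size D < s"
  shows "derives (16 * s ^ 3) \<Gamma> (200 * s ^ 3) (disj_prod D)"
proof -
  have s1: "1 \<le> s" using D by simp
  then have s3: "1 \<le> s ^ 3" by simp
  consider "D \<in> K" | h where "h \<in> {1..n}" "D = bool_axiom h" | "reslin_step n P D"
    using line by blast
  then show ?thesis
  proof cases
    case 1
    then have "disj_prod D \<in> \<Gamma>" using ax(3) by blast
    then have "derives (16 * s ^ 3) \<Gamma> 1 (disj_prod D)"
      by (rule derives_axiom[OF _ norm_le_monomial1[OF monomial_disj_prod]]) (use s3 in linarith)
    then show ?thesis by (rule derives_le) (use s3 in linarith)
  next
    case (2 h)
    have "derives (16 * s ^ 3) \<Gamma> 9
        (yvar (Poly_Mapping.single h 1) * yvar (Poly_Mapping.single h 1 - Poly_Mapping.single 0 1))"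
      by (rule derives_bool_axiom[OF ax(1,2) 2(1)]) (use s3 in linarith)
    then have "derives (16 * s ^ 3) \<Gamma> 9 (disj_prod D)"
      by (simp only: 2(2) bool_axiom_def image_mset_add_mset image_mset_empty
          prod_mset.add_mset prod_mset.empty mult_1_right)
    then show ?thesis by (rule derives_le) (use s3 in linarith)
  next
    case 3
    then show ?thesis by (rule derives_reslin_step[OF _ ax(1,2) P D])
  qed
qed

text \<open>The cost \<open>?B\<close> of a line is charged to its size, which is positive unless
  the line is empty or consists of zero forms. Lines with the zero form cost nothing, and the empty
  disjunction is derived only once, which accounts for the 1 in \<open>s\<close>.\<close>

lemma reslin_proof_simulation:
  assumes proof_\<pi>: "reslin_proof n K \<pi> D" and K: "\<forall>Q\<in>K. disj_over n Q"
    and ax: "form_axioms n \<subseteq> \<Gamma>" "bool_polys n \<subseteq> \<Gamma>" "disj_prod ` K \<subseteq> \<Gamma>"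
    and s: "s = reslin_size \<pi> + 1"
  obtains \<rho> where "pc_derivation \<Gamma> \<rho>" "disj_prod D \<in> set \<rho>" "pc_size \<rho> \<le> 3200 * s ^ 7"
proof -
  let ?B = "200 * s ^ 3 * (16 * s ^ 3)"
  \<comment> \<open>Records whether the single extra charge for the empty disjunction has been
    spent.\<close>
  let ?e = "\<lambda>i. if {#} \<in> set (take i \<pi>) then 1 else 0 :: nat"
  have "\<exists>\<rho>. pc_derivation \<Gamma> \<rho> \<and> disj_prod ` set (take i \<pi>) \<subseteq> set \<rho> \<and>
      pc_size \<rho> \<le> ?B * (reslin_size (take i \<pi>) + ?e i)" if "i \<le> length \<pi>" for i
    using that
  proof (induction i)
    case 0
    show ?case by (intro exI[of _ "[]"]) (simp add: pc_derivation_def pc_size_def)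
  next
    case (Suc i)
    then obtain \<rho> where \<rho>: "pc_derivation \<Gamma> \<rho>" "disj_prod ` set (take i \<pi>) \<subseteq> set \<rho>"
      "pc_size \<rho> \<le> ?B * (reslin_size (take i \<pi>) + ?e i)" by auto
    have i: "i < length \<pi>" using Suc by simp
    let ?D = "\<pi> ! i"
    have take: "take (Suc i) \<pi> = take i \<pi> @ [?D]" by (rule take_Suc_conv_app_nth[OF i])
    have rs: "reslin_size (take (Suc i) \<pi>) = reslin_size (take i \<pi>) + disj_size ?D"
      by (simp add: take reslin_size_def)
    obtain \<sigma> where \<sigma>: "pc_derivation (\<Gamma> \<union> set \<rho>) \<sigma>" "disj_prod ?D \<in> set \<rho> \<union> set \<sigma>"
      "pc_size \<sigma> + ?B * ?e i \<le> ?B * (disj_size ?D + ?e (Suc i))"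
    proof -
      \<comment> \<open>Free line, repeated empty disjunction already present in
        \<open>\<rho>\<close>, and a line that pays for its own simulation.\<close>
      consider "0 \<in># ?D" | "?D = {#}" "{#} \<in> set (take i \<pi>)"
        | "0 \<notin># ?D" "?D = {#} \<longrightarrow> {#} \<notin> set (take i \<pi>)" by blast
      then show ?thesis
      proof cases
        case 1
        obtain \<sigma> where "pc_derivation \<Gamma> \<sigma>" "disj_prod ?D \<in> set \<sigma>" "pc_size \<sigma> = 0"
          by (rule zero_form_disj_prod[OF ax(1) 1])
        then show ?thesis
          by (intro that[of \<sigma>]) (auto simp: take intro: pc_derivation_mono)
      next
        case 2
        then have "disj_prod ?D \<in> set \<rho>" using \<rho>(2) imageI[of ?D _ disj_prod] by (simp only: subsetD)
        then show ?thesis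
          by (intro that[of "[]"]) (auto simp: take pc_derivation_def pc_size_def)
      next
        case 3
        have mem: "disj_size E < s" if "E \<in> set \<pi>" for E
        proof -
          have "disj_size E \<le> reslin_size \<pi>"
            unfolding reslin_size_def using that by (intro member_le_sum_list) auto
          then show ?thesis by (simp add: s)
        qed
        have "derives (16 * s ^ 3) (\<Gamma> \<union> set \<rho>) (200 * s ^ 3) (disj_prod ?D)"
        proof (rule derives_reslin_line[of n _ K _ "set (take i \<pi>)"])
          show "?D \<in> K \<or> (\<exists>h\<in>{1..n}. ?D = bool_axiom h) \<or> reslin_step n (set (take i \<pi>)) ?D"
            using proof_\<pi> i by (simp add: reslin_proof_def)
          show "disj_over n E" if E: "E \<in> set (take i \<pi>)" for E
          proof -
            obtain j where "j < length \<pi>" "E = \<pi> ! j"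
              using in_set_takeD[OF E] by (auto simp: in_set_conv_nth)
            then show ?thesis using reslin_proof_disj_over[OF proof_\<pi> K] by simp
          qed
          show "disj_size E < s" if "E \<in> set (take i \<pi>)" for E
            using mem set_take_subset[of i \<pi>] that by blast
          show "disj_prod ` set (take i \<pi>) \<subseteq> \<Gamma> \<union> set \<rho>" using \<rho>(2) by (rule le_supI2)
          show "disj_size ?D < s" by (rule mem[OF nth_mem[OF i]])
        qed (use ax 3(1) in \<open>simp_all only: le_supI1 not_False_eq_True\<close>)
        then obtain \<sigma> where \<sigma>: "pc_derivation (\<Gamma> \<union> set \<rho>) \<sigma>" "disj_prod ?D \<in> set \<sigma>" "pc_size \<sigma> \<le> ?B"
          by (rule derives_obtain)
        have "1 + ?e i \<le> disj_size ?D + ?e (Suc i)"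
        proof (cases "?D = {#}")
          case True
          with 3 show ?thesis by (simp add: take)
        next
          case False
          then have "1 \<le> disj_size ?D"
            using size_le_disj_size[OF 3(1)] by (metis One_nat_def Suc_leI le_trans nonempty_has_size)
          then show ?thesis by (auto simp: take)
        qed
        then have "?B * (1 + ?e i) \<le> ?B * (disj_size ?D + ?e (Suc i))" by (rule mult_le_mono2)
        with \<sigma> show ?thesis by (intro that[of \<sigma>]) (simp_all only: distrib_left Un_iff simp_thms)
      qed
    qed
    show ?case
    proof (intro exI[of _ "\<rho> @ \<sigma>"] conjI)
      show "pc_derivation \<Gamma> (\<rho> @ \<sigma>)" by (rule pc_derivation_append[OF \<rho>(1) \<sigma>(1)])
      show "disj_prod ` set (take (Suc i) \<pi>) \<subseteq> set (\<rho> @ \<sigma>)"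
        using \<rho>(2) \<sigma>(2) by (auto simp: take)
      show "pc_size (\<rho> @ \<sigma>) \<le> ?B * (reslin_size (take (Suc i) \<pi>) + ?e (Suc i))"
        using \<rho>(3) \<sigma>(3) unfolding pc_size_append rs distrib_left by linarith
    qed
  qed
  from this[of "length \<pi>"] obtain \<rho> where \<rho>: "pc_derivation \<Gamma> \<rho>" "disj_prod ` set \<pi> \<subseteq> set \<rho>"
      "pc_size \<rho> \<le> ?B * (reslin_size \<pi> + (if {#} \<in> set \<pi> then 1 else 0))"
    by auto
  have "D \<in> set \<pi>" using proof_\<pi> by (auto simp: reslin_proof_def)
  then have "disj_prod D \<in> set \<rho>" using \<rho>(2) by blast
  moreover have "?B * (reslin_size \<pi> + (if {#} \<in> set \<pi> then 1 else 0)) \<le> ?B * s"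
    by (intro mult_le_mono2) (simp add: s)
  moreover have "s ^ 7 = s ^ 3 * s ^ 3 * s" using power_add[of s 3 3] power_add[of s 6 1] by simp
  then have "?B * s = 3200 * s ^ 7" by simp
  ultimately show ?thesis using that[OF \<rho>(1)] \<rho>(3) by linarith
qed

section \<open>Extension axioms\<close>

lemma poly_vars_add: "poly_vars (R + S) \<subseteq> poly_vars R \<union> poly_vars S"
  unfolding poly_vars_def using keys_add[of R S] by blast

lemma poly_vars_diff: "poly_vars (R - S) \<subseteq> poly_vars R \<union> poly_vars S"
  unfolding poly_vars_def using keys_diff[of R S] by blast

lemma poly_vars_mult: "poly_vars (R * S) \<subseteq> poly_vars R \<union> poly_vars S"
proof
  fix v assume "v \<in> poly_vars (R * S)"
  then obtain m where m: "m \<in> Poly_Mapping.keys (R * S)" "v \<in> Poly_Mapping.keys m"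
    by (auto simp: poly_vars_def)
  then obtain a b where "a \<in> Poly_Mapping.keys R" "b \<in> Poly_Mapping.keys S" "m = a + b"
    using keys_mult[of R S] by blast
  with m(2) keys_add[of a b] show "v \<in> poly_vars R \<union> poly_vars S"
    by (auto simp: poly_vars_def)
qed

lemma poly_vars_Const: "poly_vars (Const c) = {}"
  by (simp add: poly_vars_def Const_def)

lemma poly_vars_Var: "poly_vars (Var v) = {v}"
  by (simp add: poly_vars_def Var_def)

lemma poly_vars_affine_poly: "poly_vars (affine_poly n a) \<subseteq> range X"
proof -
  have "poly_vars (\<Sum>j\<in>J. Const (a j) * Var (X j)) \<subseteq> range X" for J
  proof (induction J rule: infinite_finite_induct)
    case (insert j J)
    then show ?case
      using poly_vars_add[of "Const (a j) * Var (X j)" "\<Sum>j\<in>J. Const (a j) * Var (X j)"]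
        poly_vars_mult[of "Const (a j)" "Var (X j)"]
      by (auto simp: poly_vars_Const poly_vars_Var)
  qed (simp_all add: poly_vars_def)
  then show ?thesis
    unfolding affine_poly_def using poly_vars_add poly_vars_Const by blast
qed

lemma poly_vars_disj_prod: "poly_vars (disj_prod D) \<subseteq> Y ` set_mset D"
proof (induction D)
  case empty
  then show ?case using poly_vars_Const[of 1] by simp
next
  case (add L D)
  then show ?case
    using poly_vars_mult[of "yvar L" "disj_prod D"] by (auto simp: poly_vars_Var)
qed

text \<open>A translation contains the axiom of every form in its product, an axiom mentions only
  its own \<open>y\<close> besides the \<open>x\<close> variables, and Boolean axioms mention no
  \<open>y\<close>. This is the closure condition of \<open>sps_pc_derivationI\<close>.\<close>

lemma form_axiom_in_translation:
  assumes "Y L \<in> poly_vars R" "R \<in> (\<Union>Q\<in>K. hat n Q) \<union> bool_polys n"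
  shows "yvar L - lin n L \<in> (\<Union>Q\<in>K. hat n Q) \<union> bool_polys n"
proof -
  consider Q where "Q \<in> K" "R = disj_prod Q"
    | Q M where "Q \<in> K" "M \<in># Q" "R = yvar M - lin n M"
    | h where "R = Var (X h) * Var (X h) - Var (X h)"
    using assms(2) by (auto simp: hat_eq bool_polys_def power2_eq_square)
  then show ?thesis
  proof cases
    case 1
    then show ?thesis using assms(1) poly_vars_disj_prod[of Q] by (auto simp: hat_eq)
  next
    case 2
    then have "Y L \<in> {Y M} \<union> range X"
      using assms(1) poly_vars_diff[of "yvar M" "lin n M"]
        poly_vars_affine_poly[of n "\<lambda>i. of_int (Poly_Mapping.lookup M i)"]
      unfolding lin_def by (auto simp: poly_vars_Var)
    with 2 show ?thesis by (auto simp: hat_eq)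
  next
    case 3
    then have "Y L \<in> {X h}"
      using assms(1) poly_vars_diff[of "Var (X h) * Var (X h)" "Var (X h)"]
        poly_vars_mult[of "Var (X h)" "Var (X h)"]
      by (auto simp: poly_vars_Var)
    then show ?thesis by simp
  qed
qed

text \<open>A derivation is finite, so it uses only finitely many defining axioms. Those whose variable occurs
  in \<open>\<Gamma>\<close> belong to \<open>\<Gamma>\<close>; the others become extension axioms.\<close>

lemma sps_pc_derivationI:
  assumes \<rho>: "pc_derivation (\<Gamma> \<union> form_axioms n) \<rho>"
    and \<Gamma>: "\<And>L R. R \<in> \<Gamma> \<Longrightarrow> Y L \<in> poly_vars R \<Longrightarrow> yvar L - lin n L \<in> \<Gamma>"
  shows "sps_pc_derivation n \<Gamma> \<rho>"
proof -
  have "\<exists>C\<subseteq>UNIV. finite C \<and> set \<rho> \<inter> form_axioms n = (\<lambda>L. yvar L - lin n L) ` C"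
    by (rule finite_subset_image) (simp_all add: form_axioms_def)
  then obtain C where C: "finite C" "set \<rho> \<inter> form_axioms n = (\<lambda>L. yvar L - lin n L) ` C"
    by blast
  let ?V = "\<Union>R\<in>\<Gamma>. poly_vars R"
  obtain Ls where Ls: "set Ls = {L \<in> C. Y L \<notin> ?V}" "distinct Ls"
    using finite_distinct_list[of "{L \<in> C. Y L \<notin> ?V}"] C(1) by auto
  let ?ext = "map (\<lambda>L. (Y L, \<lambda>i. rat_of_int (Poly_Mapping.lookup L i))) Ls"
  let ?\<Delta> = "\<Gamma> \<union> {Var z - affine_poly n a | z a. (z, a) \<in> set ?ext}"
  have ext: "yvar L - lin n L \<in> ?\<Delta>" if "L \<in> C" for L
  proof (cases "Y L \<in> ?V")
    case True
    then obtain R where "R \<in> \<Gamma>" "Y L \<in> poly_vars R" by blast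
    then have "yvar L - lin n L \<in> \<Gamma>" by (rule \<Gamma>)
    then show ?thesis by (rule UnI1)
  next
    case False
    with that have "L \<in> set Ls" by (simp add: Ls)
    then have "(Y L, \<lambda>i. rat_of_int (Poly_Mapping.lookup L i)) \<in> set ?ext" by simp
    then show ?thesis unfolding lin_def by (intro UnI2 CollectI exI conjI) (rule refl)
  qed
  have "set \<rho> \<inter> (\<Gamma> \<union> form_axioms n) \<subseteq> ?\<Delta>"
  proof
    fix R assume R: "R \<in> set \<rho> \<inter> (\<Gamma> \<union> form_axioms n)"
    show "R \<in> ?\<Delta>"
    proof (cases "R \<in> \<Gamma>")
      case False
      with R C(2) have "R \<in> (\<lambda>L. yvar L - lin n L) ` C" by blast
      with ext show ?thesis by blast
    qed simp
  qed
  then have \<Delta>: "R \<in> ?\<Delta>" if "R \<in> set \<rho>" "R \<in> \<Gamma> \<union> form_axioms n" for R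
    using that by (simp only: subset_iff Int_iff simp_thms)
  have "pc_derivation ?\<Delta> \<rho>"
    unfolding pc_derivation_def
  proof (intro allI impI)
    fix i assume i: "i < length \<rho>"
    then have "\<rho> ! i \<in> \<Gamma> \<union> form_axioms n \<or> pc_step (set (take i \<rho>)) (\<rho> ! i)"
      using \<rho> unfolding pc_derivation_def by simp
    then show "\<rho> ! i \<in> ?\<Delta> \<or> pc_step (set (take i \<rho>)) (\<rho> ! i)"
      using \<Delta>[OF nth_mem[OF i]] by (elim disj_forward) simp_all
  qed
  moreover have "distinct (map fst ?ext)"
    using Ls(2) by (simp add: distinct_map inj_on_def)
  moreover have "\<forall>(z, a)\<in>set ?ext. z \<notin> range X \<and> z \<notin> ?V"
  proof
    fix p assume "p \<in> set ?ext"
    then obtain L where "p = (Y L, \<lambda>i. rat_of_int (Poly_Mapping.lookup L i))" "L \<in> set Ls" by auto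
    then show "case p of (z, a) \<Rightarrow> z \<notin> range X \<and> z \<notin> ?V" by (simp add: Ls(1) image_iff)
  qed
  ultimately show ?thesis unfolding sps_pc_derivation_def by (intro exI[of _ ?ext] conjI)
qed

section \<open>The total size bound\<close>

lemma sum_set_mset_le_disj_size: "(\<Sum>L\<in>set_mset D. affine_size L) \<le> disj_size D"
proof (induction D)
  case (add L D)
  then show ?case
    by (cases "L \<in># D") (simp_all add: disj_size_add_mset insert_absorb)
qed simp

text \<open>The axiom of a nonzero form has norm at most its unary size plus 1, hence at most twice
  that size. The zero form occurs at most once in the set and accounts for the added 1.\<close>

lemma sum_form_axioms_size:
  "(\<Sum>L\<in>set_mset D. qpoly_size (yvar L - lin n L)) \<le> 2 * disj_size D + 1"
proof -
  have "(\<Sum>L\<in>set_mset D. qpoly_size (yvar L - lin n L)) \<le> (\<Sum>L\<in>set_mset D. 2 * affine_size L + (if L = 0 then 1 else 0))"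
  proof (intro sum_mono)
    fix L :: affine
    have "qpoly_size (yvar L - lin n L) \<le> affine_size L + 1"
      by (intro qpoly_size_le norm_le_form_axiom) simp
    then show "qpoly_size (yvar L - lin n L) \<le> 2 * affine_size L + (if L = 0 then 1 else 0)"
      using affine_size_eq_0[of L] by auto
  qed
  also have "\<dots> \<le> 2 * (\<Sum>L\<in>set_mset D. affine_size L) + 1"
    by (simp add: sum.distrib sum_distrib_left)
  also have "(\<Sum>L\<in>set_mset D. affine_size L) \<le> disj_size D"
    by (rule sum_set_mset_le_disj_size)
  finally show ?thesis by simp
qed

theorem theorem4p2:
  shows "\<exists>(p :: real poly) (C :: real).
    \<forall>(n :: nat) (Qs :: disjunction list) (\<pi> :: disjunction list) (D :: disjunction).
      (\<forall>Q\<in>set Qs. disj_over n Q) \<longrightarrow> reslin_proof n (set Qs) \<pi> D \<longrightarrow>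
      (\<exists>\<rho>. sps_pc_derivation n ((\<Union>Q\<in>set Qs. hat n Q) \<union> bool_polys n) \<rho> \<and>
           hat n D \<subseteq> set \<rho> \<and>
           real (pc_size \<rho>) \<le> C * poly p (real (reslin_size \<pi>)))"
\<comment> \<open>The polynomial is \<open>(1 + x)^7\<close>, that is \<open>s^7\<close>. The
  constant is 3200 for the simulation plus 2 for the defining axioms of the forms in
  \<open>D\<close>.\<close>
proof (intro exI[of _ "[:1, 1:] ^ 7"] exI[of _ 3202] allI impI)
  fix n Qs \<pi> D
  assume Qs: "\<forall>Q\<in>set Qs. disj_over n Q" and \<pi>: "reslin_proof n (set Qs) \<pi> D"
  let ?\<Gamma> = "(\<Union>Q\<in>set Qs. hat n Q) \<union> bool_polys n"
  define s where "s = reslin_size \<pi> + 1"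
  obtain \<rho> where \<rho>: "pc_derivation (?\<Gamma> \<union> form_axioms n) \<rho>" "disj_prod D \<in> set \<rho>"
      "pc_size \<rho> \<le> 3200 * s ^ 7"
    by (rule reslin_proof_simulation[OF \<pi> Qs _ _ _ s_def, of "?\<Gamma> \<union> form_axioms n"])
      (auto simp: hat_eq)
  obtain Ls where Ls: "set Ls = set_mset D" "distinct Ls"
    using finite_distinct_list[of "set_mset D"] by auto
  let ?\<sigma> = "map (\<lambda>L. yvar L - lin n L) Ls"
  have "D \<in> set \<pi>" using \<pi> by (auto simp: reslin_proof_def)
  then have "disj_size D \<le> reslin_size \<pi>"
    unfolding reslin_size_def by (intro member_le_sum_list) auto
  moreover have "pc_size ?\<sigma> = (\<Sum>L\<in>set_mset D. qpoly_size (yvar L - lin n L))"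
    by (simp add: pc_size_def sum.distinct_set_conv_list[OF Ls(2), symmetric] flip: Ls(1))
  ultimately have "pc_size ?\<sigma> \<le> 2 * s"
    using sum_form_axioms_size[where D = D and n = n] by (simp add: s_def)
  also have "\<dots> \<le> 2 * s ^ 7" using self_le_power[of s 7] by (simp add: s_def)
  finally have "pc_size (\<rho> @ ?\<sigma>) \<le> 3202 * s ^ 7" using \<rho>(3) by (simp add: pc_size_append)
  then have "real (pc_size (\<rho> @ ?\<sigma>)) \<le> real (3202 * s ^ 7)" by (rule of_nat_mono)
  also have "\<dots> = 3202 * poly ([:1, 1:] ^ 7) (real (reslin_size \<pi>))"
    by (simp add: poly_power s_def)
  finally have size: "real (pc_size (\<rho> @ ?\<sigma>)) \<le> 3202 * poly ([:1, 1:] ^ 7) (real (reslin_size \<pi>))" .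
  have "pc_derivation (?\<Gamma> \<union> form_axioms n) (\<rho> @ ?\<sigma>)"
    by (rule pc_derivation_append[OF \<rho>(1)]) (auto simp: pc_derivation_def form_axioms_def)
  then have "sps_pc_derivation n ?\<Gamma> (\<rho> @ ?\<sigma>)"
    by (rule sps_pc_derivationI) (rule form_axiom_in_translation)
  moreover have "hat n D \<subseteq> set (\<rho> @ ?\<sigma>)"
    using \<rho>(2) Ls(1) by (auto simp: hat_eq)
  ultimately show "\<exists>\<rho>. sps_pc_derivation n ?\<Gamma> \<rho> \<and> hat n D \<subseteq> set \<rho> \<and>
      real (pc_size \<rho>) \<le> 3202 * poly ([:1, 1:] ^ 7) (real (reslin_size \<pi>))"
    using size by blast
qed

end
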